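(* Let $p\ge1$ and $0\le\ell\le p$ be integers, let $f\in\mathcal E_p$ with zeros $-\lambda_m$ ($0\le\lambda_1\le\lambda_2\le\cdots$, counted with multiplicity), and let $0\le a_1\le\cdots\le a_n$ and $0\le b_1\le\cdots\le b_n$ be real numbers. Let $W_f(z)=\prod_{k=1}^n f(z+a_k)\big/\prod_{k=1}^n f(z+b_k)$. If $\sum_{k=1}^n a_k^j=\sum_{k=1}^n b_k^j$ for $0\le j\le\ell$ and if $b-\mathcal Z_f\prec_w a-\mathcal Z_f$, then $(-1)^{p-\ell+1}\partial_z^{p-\ell}\log W_f(z)$ is a generalised Stieltjes function of order $p-\ell+2$, with the representation, for $\Re z>0$, $$(-1)^{p-\ell+1}\partial_z^{p-\ell}\log W_f(z)=\int_0^\infty e^{-sz}s^{p-\ell+1}h(s)g(s)\,ds=\Gamma(p-\ell+2)\int_0^\infty\frac{\phi(t)\,dt}{(z+t)^{p-\ell+2}},$$ where, for $s>0$, $h(s)=\sum_{m\ge1}e^{-\lambda_m s}$, $g(s)=\frac1{s^2}\sum_{k=1}^n(e^{-sa_k}-e^{-sb_k})$, and where $\phi(t)=\sum_{m\ge1}\rho(t-\lambda_m)$ with $$\rho(t)=\sum_{k=1}^n (t-a_k)\mathbf 1_{[a_k,\infty)}(t)-\sum_{k=1}^n (t-b_k)\mathbf 1_{[b_k,\infty)}(t).$$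
   Context: $\mathcal E_p$ denotes the class of entire functions $f$ that are real on the real axis, of genus $p$, have only real and non-positive zeros, and satisfy $f(x)>0$ for $x>0$. The zeros are written $-\lambda_m$, listed with multiplicity, and sums over $m$ run over all zeros. $\log f$ denotes the holomorphic branch on $\mathbb C\setminus(-\infty,0]$ that is real on $(0,\infty)$, and $\log W_f(z)=\sum_{k=1}^n(\log f(z+a_k)-\log f(z+b_k))$. $\partial_z$ is differentiation with respect to $z$ ($\partial_z^0$ the identity), $\mathbf 1_S$ is the indicator function of $S$, and $0^0=1$ in the power sums. $\mathcal Z_f$ is the sequence of zeros of $f$ with multiplicity. For a finite sequence $a=(a_1,\ldots,a_n)$ of non-negative numbers, $a-\mathcal Z_f$ denotes the non-decreasing rearrangement $(\mu_{a,k})_{k\ge1}$ of the numbers $a_j-\zeta$, $1\le j\le n$, $\zeta\in\mathcal Z_f$, counted with multiplicity (these are the negatives of the zeros of $\prod_{j=1}^n f(z+a_j)$). The relation $b-\mathcal Z_f\prec_w a-\mathcal Z_f$ means $\sum_{k=1}^m\mu_{a,k}\le\sum_{k=1}^m\mu_{b,k}$ for all $m\ge1$. A function $F$ on $(0,\infty)$ is a generalised Stieltjes function of order $\lambda>0$ if $F(x)=\int_0^\infty \frac{d\mu(t)}{(t+x)^\lambda}+c$ for all $x>0$, for some positive (i.e. non-negative) measure $\mu$ on $[0,\infty)$ making the integral converge and some $c\ge 0$. A function of a complex variable is called generalised Stieltjes if its restriction to $(0,\infty)$ is. *)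

theory Defs
  imports "HOL-Complex_Analysis.Complex_Analysis" "HOL-Library.Extended_Nat"
begin

text \<open>
  Finite and infinite sequences are treated together: a sequence of length \<open>N :: enat\<close> is a
  function on \<open>nat\<close> of which only the values at the indices \<open>m\<close> with \<open>1 \<le> m \<le> N\<close> matter.
\<close>

definition idx :: "enat \<Rightarrow> nat set" where
  "idx N = {m. 1 \<le> m \<and> enat m \<le> N}"

text \<open>
  The genus in the sense of Hadamard's theorem:
  \<open>f z = z ^ r * exp (Q z) * (\<Prod>k. E d (z / c k))\<close>, where \<open>E d\<close> is the elementary factor of
  degree \<open>d\<close>, the \<open>c k\<close> are the nonzero zeros of \<open>f\<close> with multiplicity, \<open>d\<close> is the least number
  such that \<open>\<Sum>k. 1 / \<bar>c k\<bar> ^ (d + 1)\<close> converges, and the genus is \<open>max d (degree Q)\<close>.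
\<close>

definition has_genus :: "(complex \<Rightarrow> complex) \<Rightarrow> nat \<Rightarrow> bool" where
  "has_genus f p \<longleftrightarrow>
     (\<exists>(r :: nat) (Q :: complex poly) (d :: nat) (N :: enat) (c :: nat \<Rightarrow> complex).
        (\<forall>k\<in>idx N. c k \<noteq> 0) \<and>
        (\<lambda>k. 1 / norm (c k) ^ (d + 1)) summable_on idx N \<and>
        (\<forall>d'<d. \<not> (\<lambda>k. 1 / norm (c k) ^ (d' + 1)) summable_on idx N) \<and>
        (\<forall>z. \<exists>P. (\<lambda>k. if k \<in> idx N then weierstrass_factor d (z / c k) else 1) has_prod P \<and>
                 f z = z ^ r * exp (poly Q z) * P) \<and>
        p = max d (degree Q))"

definition class_E :: "nat \<Rightarrow> (complex \<Rightarrow> complex) set" where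
  "class_E p =
     {f. f holomorphic_on UNIV \<and> has_genus f p \<and>
         (\<forall>x::real. f (of_real x) \<in> \<real>) \<and>
         (\<forall>z. f z = 0 \<longrightarrow> Im z = 0 \<and> Re z \<le> 0) \<and>
         (\<forall>x::real. x > 0 \<longrightarrow> Re (f (of_real x)) > 0)}"

text \<open>
  The zeros of \<open>f\<close> are \<open>- lam m\<close>, \<open>m \<in> idx N\<close>, with multiplicity. For entire \<open>f\<close>, not identically
  zero, \<^term>\<open>zorder f z\<close> is the multiplicity of the zero \<open>z\<close>, and it is \<open>0\<close> if \<open>f z \<noteq> 0\<close>.
\<close>

definition zero_sequence :: "(complex \<Rightarrow> complex) \<Rightarrow> enat \<Rightarrow> (nat \<Rightarrow> real) \<Rightarrow> bool" where
  "zero_sequence f N lam \<longleftrightarrow>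
     mono_on (idx N) lam \<and>
     (\<forall>z. finite {m \<in> idx N. z = - of_real (lam m)} \<and>
          int (card {m \<in> idx N. z = - of_real (lam m)}) = zorder f z)"

text \<open>
  \<open>\<mu>\<close> is the non-decreasing rearrangement, of length \<open>M\<close>, of the family \<open>F\<close> indexed by \<open>J\<close>.
\<close>

definition nondecr_rearrangement ::
    "'i set \<Rightarrow> ('i \<Rightarrow> real) \<Rightarrow> enat \<Rightarrow> (nat \<Rightarrow> real) \<Rightarrow> bool" where
  "nondecr_rearrangement J F M \<mu> \<longleftrightarrow>
     mono_on (idx M) \<mu> \<and> (\<exists>\<pi>. bij_betw \<pi> (idx M) J \<and> (\<forall>k\<in>idx M. \<mu> k = F (\<pi> k)))"

text \<open>The sequence \<open>a - Z\<close>, where \<open>Z\<close> is the sequence of zeros \<open>- lam m\<close>, \<open>m \<in> idx N\<close>.\<close>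

definition minus_zeros ::
    "nat \<Rightarrow> (nat \<Rightarrow> real) \<Rightarrow> enat \<Rightarrow> (nat \<Rightarrow> real) \<Rightarrow> enat \<Rightarrow> (nat \<Rightarrow> real) \<Rightarrow> bool" where
  "minus_zeros n a N lam M \<mu> \<longleftrightarrow>
     nondecr_rearrangement ({1..n} \<times> idx N) (\<lambda>(j, m). a j - (- lam m)) M \<mu>"

text \<open>
  The relation \<open>b - Z \<prec>\<^sub>w a - Z\<close>. The rearrangements exist for the zeros of an entire function that
  is not identically zero (these have no finite accumulation point), and their values on \<open>idx M\<close>
  are unique.
\<close>

definition weakly_majorized ::
    "nat \<Rightarrow> (nat \<Rightarrow> real) \<Rightarrow> (nat \<Rightarrow> real) \<Rightarrow> enat \<Rightarrow> (nat \<Rightarrow> real) \<Rightarrow> bool" where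
  "weakly_majorized n b a N lam \<longleftrightarrow>
     (\<exists>M \<mu>b \<mu>a. minus_zeros n b N lam M \<mu>b \<and> minus_zeros n a N lam M \<mu>a \<and>
        (\<forall>m\<in>idx M. (\<Sum>k=1..m. \<mu>a k) \<le> (\<Sum>k=1..m. \<mu>b k)))"

text \<open>
  On \<open>- \<real>\<^sub>\<le>\<^sub>0\<close> the branch is unique up to multiples of \<open>2 * pi * \<i>\<close>, and reality on
  the positive axis removes that freedom; elsewhere the value is arbitrary.
\<close>

definition log_branch :: "(complex \<Rightarrow> complex) \<Rightarrow> complex \<Rightarrow> complex" where
  "log_branch f =
     (SOME L. L holomorphic_on (- \<real>\<^sub>\<le>\<^sub>0) \<and> (\<forall>z \<in> - \<real>\<^sub>\<le>\<^sub>0. exp (L z) = f z) \<and>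
              (\<forall>x::real. x > 0 \<longrightarrow> L (of_real x) \<in> \<real>))"

text \<open>
  The branch of the logarithm of
  \<open>W z = (\<Prod>k=1..n. f (z + a k)) / (\<Prod>k=1..n. f (z + b k))\<close>.
\<close>

definition log_W ::
    "(complex \<Rightarrow> complex) \<Rightarrow> nat \<Rightarrow> (nat \<Rightarrow> real) \<Rightarrow> (nat \<Rightarrow> real) \<Rightarrow> complex \<Rightarrow> complex" where
  "log_W f n a b z =
     (\<Sum>k=1..n. log_branch f (z + of_real (a k)) - log_branch f (z + of_real (b k)))"

definition gen_stieltjes :: "real \<Rightarrow> (real \<Rightarrow> real) \<Rightarrow> bool" where
  "gen_stieltjes r F \<longleftrightarrow>
     r > 0 \<and>
     (\<exists>(\<mu> :: real measure) (c :: real). sets \<mu> = sets (restrict_space borel {0..}) \<and> c \<ge> 0 \<and>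
        (\<forall>x>0. integrable \<mu> (\<lambda>t. 1 / (t + x) powr r) \<and>
               F x = (\<integral>t. 1 / (t + x) powr r \<partial>\<mu>) + c))"

definition gen_stieltjes_complex :: "real \<Rightarrow> (complex \<Rightarrow> complex) \<Rightarrow> bool" where
  "gen_stieltjes_complex r F \<longleftrightarrow>
     (\<exists>G. gen_stieltjes r G \<and> (\<forall>x::real. x > 0 \<longrightarrow> F (of_real x) = of_real (G x)))"

definition h_fun :: "enat \<Rightarrow> (nat \<Rightarrow> real) \<Rightarrow> real \<Rightarrow> real" where
  "h_fun N lam s = (\<Sum>\<^sub>\<infinity>m\<in>idx N. exp (- lam m * s))"

definition g_fun :: "nat \<Rightarrow> (nat \<Rightarrow> real) \<Rightarrow> (nat \<Rightarrow> real) \<Rightarrow> real \<Rightarrow> real" where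
  "g_fun n a b s = 1 / s ^ 2 * (\<Sum>k=1..n. exp (- s * a k) - exp (- s * b k))"

definition rho_fun :: "nat \<Rightarrow> (nat \<Rightarrow> real) \<Rightarrow> (nat \<Rightarrow> real) \<Rightarrow> real \<Rightarrow> real" where
  "rho_fun n a b t =
     (\<Sum>k=1..n. (t - a k) * indicator {a k..} t) - (\<Sum>k=1..n. (t - b k) * indicator {b k..} t)"

definition phi_fun ::
    "nat \<Rightarrow> (nat \<Rightarrow> real) \<Rightarrow> (nat \<Rightarrow> real) \<Rightarrow> enat \<Rightarrow> (nat \<Rightarrow> real) \<Rightarrow> real \<Rightarrow> real" where
  "phi_fun n a b N lam t = (\<Sum>\<^sub>\<infinity>m\<in>idx N. rho_fun n a b (t - lam m))"

end

theory Submission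
  imports Defs "HOL-Probability.Sinc_Integral"
begin

text \<open>
  Up to a polynomial, the logarithm of \<open>f\<close> is a sum of the logarithms \<open>log (z + \<lambda>\<^sub>m)\<close> over the
  zeros, made convergent by further polynomials; this is Hadamard's factorization, and all the
  polynomials have degree at most the genus \<open>p\<close>. Forming \<open>log W\<close> replaces a polynomial \<open>P\<close> by
  \<open>\<Sum>k. P (z + a\<^sub>k) - P (z + b\<^sub>k)\<close>. As the power sums of \<open>a\<close> and \<open>b\<close> agree up to the exponent \<open>l\<close>,
  this difference has degree less than \<open>p - l\<close>, and the derivative of order \<open>q = p - l\<close> kills it. What is
  left is a series whose terms are differences of derivatives of the logarithm, and
  \<open>(-1)\<^bsup>q+1\<^esup> (log\<^bsup>(q)\<^esup> (w + a) - log\<^bsup>(q)\<^esup> (w + b)) = \<integral> e\<^bsup>-sw\<^esup> s\<^bsup>q-1\<^esup> (e\<^bsup>-sa\<^esup> - e\<^bsup>-sb\<^esup>) ds\<close>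
  for \<open>Re w > 0\<close> (\<open>laplace_Ln_deriv_diff\<close>). With \<open>w = z + \<lambda>\<^sub>m\<close>, the sum over \<open>m\<close> of the integrands is
  \<open>e\<^bsup>-sz\<^esup> s\<^bsup>q+1\<^esup> h(s) g(s)\<close>.

  It remains to sum under the integral, and no function dominating the partial sums of the
  integrands is available in advance. Their sign supplies one. Since \<open>g\<close> and \<open>h g\<close> are the Laplace
  transforms of \<open>\<rho>\<close> and \<open>\<phi>\<close> (\<open>laplace_phi\<close>), and \<open>\<phi>\<close> is non-negative by weak majorization
  (\<open>phi_fun_nonneg\<close>), \<open>h g\<close> is non-negative, hence so is \<open>g\<close> unless there are no zeros. For real \<open>z\<close>
  the partial integrands therefore increase and their integrals converge, so that monotone
  convergence makes the limit integrable; for complex \<open>z\<close> this limit dominates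
  (\<open>higher_deriv_log_W_laplace\<close>). Inserting \<open>h(s) g(s) = \<integral> e\<^bsup>-st\<^esup> \<phi>(t) dt\<close> and exchanging the two
  integrals, which is allowed as \<open>\<phi> \<ge> 0\<close>, turns the Laplace integral into the Stieltjes integral of \<open>\<phi>\<close>
  (\<open>stieltjes_of_laplace\<close>), and \<open>\<phi>\<close> is the density of the representing measure up to a factor.

  Two points link this to the hypotheses on \<open>f\<close>. The branch \<open>log_branch f\<close> differs from the
  logarithm read off the product by a constant (\<open>log_branch_eq\<close>), which cancels in \<open>log W\<close>. And the
  sequence of zeros with multiplicity is a rearrangement of the zeros of the factors, because the
  order of \<open>f\<close> at a point counts the factors vanishing there, with \<open>z\<^bsup>r\<^esup>\<close> counted \<open>r\<close> times
  (\<open>zorder_eq_card\<close>, \<open>zero_sequence_bij\<close>).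
\<close>

section \<open>Laplace integrals of powers and of truncated linear functions\<close>

lemma integrable_power_exp:
  assumes "0 < x"
  shows "integrable lborel (\<lambda>s::real. indicator {0<..} s *\<^sub>R (s ^ k * exp (- s * x)))"
proof -
  have "integrable lborel (\<lambda>s::real. s ^ k * exp (- s) * indicator {0<..} s)"
    using has_bochner_integral_I0i_power_exp_m[of k] by (simp add: has_bochner_integral_iff)
  then have "integrable lborel (\<lambda>s::real. (0 + x * s) ^ k * exp (- (0 + x * s)) * indicator {0<..} (0 + x * s))"
    using assms by (subst lborel_integrable_real_affine_iff) auto
  then have "integrable lborel (\<lambda>s::real. (1 / x ^ k) * ((0 + x * s) ^ k * exp (- (0 + x * s)) * indicator {0<..} (0 + x * s)))"
    by (rule integrable_mult_right)
  also have "?this \<longleftrightarrow> ?thesis"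
    using assms
    by (intro arg_cong[where f = "integrable lborel"] ext)
      (auto simp: indicator_def field_simps power_mult_distrib zero_less_mult_iff)
  finally show ?thesis .
qed

lemma integrable_power_exp_complex:
  assumes "0 < Re w"
  shows "integrable lborel (\<lambda>s::real. indicator {0<..} s *\<^sub>R (of_real (s ^ k) * exp (- of_real s * w)))"
  by (rule Bochner_Integration.integrable_bound[OF integrable_power_exp[OF assms, of k]])
    (auto simp: norm_mult norm_power indicator_def)

lemma tendsto_power_exp_complex:
  assumes "0 < Re w"
  shows "((\<lambda>s::real. of_real (s ^ k) * exp (- of_real s * w)) \<longlongrightarrow> 0) at_top"
proof (rule tendsto_norm_zero_cancel)
  have "((\<lambda>s::real. inverse (Re w) ^ k * ((s * Re w) ^ k / exp (s * Re w))) \<longlongrightarrow> inverse (Re w) ^ k * 0) at_top"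
    using assms
    by (intro tendsto_mult_left filterlim_compose[OF tendsto_power_div_exp_0]
        filterlim_at_top_mult_tendsto_pos[OF tendsto_const]) (auto simp: filterlim_ident)
  moreover have "\<forall>\<^sub>F s in at_top. inverse (Re w) ^ k * ((s * Re w) ^ k / exp (s * Re w))
      = norm (of_real (s ^ k) * exp (- of_real s * w))"
    using eventually_gt_at_top[of 0]
    by eventually_elim
      (use assms in \<open>simp add: norm_mult norm_power norm_divide power_mult_distrib exp_minus field_simps\<close>)
  ultimately show "((\<lambda>s::real. norm (of_real (s ^ k) * exp (- of_real s * w))) \<longlongrightarrow> 0) at_top"
    by (simp add: tendsto_cong)
qed

text \<open>
  Gamma's integral for a complex rate. The substitution to a real rate would need a rotation of the
  contour, so the values come from integration by parts instead, by induction on the exponent.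
\<close>
lemma laplace_power:
  assumes "0 < Re w"
  shows "has_bochner_integral lborel
           (\<lambda>s::real. indicator {0<..} s *\<^sub>R (of_real (s ^ k) * exp (- of_real s * w)))
           (fact k / w ^ Suc k)"
proof -
  define f where "f = (\<lambda>k (s::real). of_real (s ^ k) * exp (- of_real s * w))"
  have w: "w \<noteq> 0" using assms by auto
  have int: "integrable lborel (\<lambda>s. indicator {0<..} s *\<^sub>R f k s)" for k
    unfolding f_def by (rule integrable_power_exp_complex[OF assms])
  \<comment> \<open>The fundamental theorem on the half-line, for antiderivatives vanishing at infinity.\<close>
  have lim: "(LBINT s=0..\<infinity>. f' s) = - F 0"
    if F: "\<And>s. (F has_vector_derivative f' s) (at s)" and "\<And>s. isCont f' s"
      and "integrable lborel (\<lambda>s. indicator {0<..} s *\<^sub>R f' s)" and "(F \<longlongrightarrow> 0) at_top" for F f' :: "real \<Rightarrow> complex"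
  proof -
    have "(LBINT s=ereal 0..\<infinity>. f' s) = 0 - F 0"
    proof (rule interval_integral_FTC_integrable)
      show "set_integrable lborel (einterval (ereal 0) \<infinity>) f'"
        using that by (simp add: set_integrable_def einterval_def greaterThan_def)
      have "isCont F 0"
        using F[of 0] by (rule has_vector_derivative_continuous)
      then have "(F \<longlongrightarrow> F 0) (at_right 0)"
        by (simp add: isCont_def filterlim_at_split)
      then show "((F \<circ> real_of_ereal) \<longlongrightarrow> F 0) (at_right (ereal 0))"
        unfolding o_def by (subst at_right_ereal) (simp add: filterlim_filtermap)
      show "((F \<circ> real_of_ereal) \<longlongrightarrow> 0) (at_left \<infinity>)"
        unfolding o_def using that by (subst at_left_PInf) (simp add: filterlim_filtermap)
    qed (use that in auto)
    then show ?thesis by (simp add: zero_ereal_def)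
  qed
  have contf: "isCont (f k) s" for k s
    unfolding f_def by (intro continuous_intros)
  have "(LBINT s=0..\<infinity>. f k s) = fact k / w ^ Suc k"
  proof (induction k)
    case 0
    have "(LBINT s=0..\<infinity>. f 0 s) = - (- exp (- of_real 0 * w) / w)"
    proof (rule lim)
      show "((\<lambda>s::real. - exp (- of_real s * w) / w) has_vector_derivative f 0 s) (at s)" for s
        using w by (auto simp: f_def intro!: derivative_eq_intros has_vector_derivative_real_field)
      show "((\<lambda>s::real. - exp (- of_real s * w) / w) \<longlongrightarrow> 0) at_top"
        using tendsto_divide[OF tendsto_minus[OF tendsto_power_exp_complex[OF assms, of 0]] tendsto_const[of w] w]
        by simp
    qed (use contf int in auto)
    then show ?case by simp
  next
    case (Suc k)
    define f' where "f' = (\<lambda>s. of_nat (Suc k) * f k s - w * f (Suc k) s)"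
    have "(LBINT s=0..\<infinity>. f' s) = - f (Suc k) 0"
    proof (rule lim)
      show "(f (Suc k) has_vector_derivative f' s) (at s)" for s
        unfolding f_def f'_def of_real_power
        by (rule has_vector_derivative_real_field)
          (rule derivative_eq_intros refl | simp add: algebra_simps del: power_Suc)+
      show "(f (Suc k) \<longlongrightarrow> 0) at_top"
        unfolding f_def by (rule tendsto_power_exp_complex[OF assms])
      show "isCont f' s" for s
        unfolding f'_def by (intro continuous_intros contf)
      have "integrable lborel (\<lambda>s. of_nat (Suc k) * (indicator {0<..} s *\<^sub>R f k s) - w * (indicator {0<..} s *\<^sub>R f (Suc k) s))"
        by (intro Bochner_Integration.integrable_diff integrable_mult_right int)
      then show "integrable lborel (\<lambda>s. indicator {0<..} s *\<^sub>R f' s)"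
        unfolding f'_def by (simp add: scaleR_diff_right)
    qed
    moreover have "(LBINT s=0..\<infinity>. f' s) = of_nat (Suc k) * (LBINT s=0..\<infinity>. f k s) - w * (LBINT s=0..\<infinity>. f (Suc k) s)"
    proof -
      have "interval_lebesgue_integrable lborel 0 \<infinity> (f k)" for k
        using int[of k] by (simp add: interval_lebesgue_integrable_def set_integrable_def zero_ereal_def einterval_def greaterThan_def)
      then show ?thesis unfolding f'_def
        by (subst interval_lebesgue_integral_diff) auto
    qed
    ultimately have "w * (LBINT s=0..\<infinity>. f (Suc k) s) = of_nat (Suc k) * (fact k / w ^ Suc k)"
      using Suc by (simp add: f_def)
    then show ?case using w by (simp add: field_simps)
  qed
  moreover have "(LBINT s=0..\<infinity>. f k s) = (LINT s|lborel. indicator {0<..} s *\<^sub>R f k s)"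
    by (simp add: interval_lebesgue_integral_def set_lebesgue_integral_def zero_ereal_def einterval_def greaterThan_def)
  ultimately show ?thesis
    using int[of k] by (simp add: has_bochner_integral_iff f_def)
qed

text \<open>
  Truncated linear functions \<open>(t - c)\<^sub>+\<close> are the summands of \<open>\<rho>\<close>; their transforms are shifts of the
  one with \<open>c = 0\<close>.
\<close>
lemma laplace_hinge:
  assumes "0 < s" "0 \<le> c"
  shows "has_bochner_integral lborel (\<lambda>t::real. indicator {0<..} t * (exp (- s * t) * max 0 (t - c)))
           (exp (- c * s) / s ^ 2)"
proof -
  have "has_bochner_integral lborel (\<lambda>u::real. indicator {0<..} u * (u * exp (- s * u))) (1 / s ^ 2)"
  proof -
    have "exp (- of_real u * of_real s) = complex_of_real (exp (- s * u))" for u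
      by (simp add: mult.commute flip: exp_of_real)
    then show ?thesis
      using has_bochner_integral_Re[OF laplace_power[of "of_real s" 1]] assms
      by (simp add: power2_eq_square flip: of_real_mult)
  qed
  then have "has_bochner_integral lborel (\<lambda>t::real. indicator {0<..} (- c + 1 * t) * ((- c + 1 * t) * exp (- s * (- c + 1 * t)))) ((1 / s ^ 2) /\<^sub>R \<bar>1\<bar>)"
    by (subst lborel_has_bochner_integral_real_affine_iff[symmetric]) auto
  then have "has_bochner_integral lborel (\<lambda>t::real. exp (- c * s) * (indicator {0<..} (- c + 1 * t) * ((- c + 1 * t) * exp (- s * (- c + 1 * t))))) (exp (- c * s) * ((1 / s ^ 2) /\<^sub>R \<bar>1\<bar>))"
    by (rule has_bochner_integral_mult_right)
  moreover have "exp (- c * s) * (indicator {0<..} (- c + 1 * t) * ((- c + 1 * t) * exp (- s * (- c + 1 * t)))) =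
     indicator {0<..} t * (exp (- s * t) * max 0 (t - c))" for t
  proof (cases "c < t")
    case True
    have "exp (- c * s) * exp (- s * (- c + 1 * t)) = exp (- s * t)"
      unfolding exp_add[symmetric] by (simp add: algebra_simps)
    then show ?thesis using True assms by (simp add: max_def algebra_simps)
  qed (use assms in \<open>simp add: max_def\<close>)
  ultimately show ?thesis by simp
qed

section \<open>Differences of derivatives of the logarithm as Laplace integrals\<close>

text \<open>
  Order \<open>0\<close>, where the function is the logarithm itself, and positive orders, where it is a power,
  are treated together. For this only the rule \<open>Ln_deriv q' = Ln_deriv (q + 1)\<close> and the values of
  positive order are needed.
\<close>
abbreviation Ln_deriv :: "nat \<Rightarrow> complex \<Rightarrow> complex" where
  "Ln_deriv q \<equiv> (deriv ^^ q) Ln"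

lemma has_field_derivative_Ln_deriv:
  assumes "z \<notin> \<real>\<^sub>\<le>\<^sub>0"
  shows "(Ln_deriv q has_field_derivative Ln_deriv (Suc q) z) (at z)"
proof -
  have op: "open (- \<real>\<^sub>\<le>\<^sub>0 :: complex set)" by (intro open_Compl) simp
  have "Ln holomorphic_on (- \<real>\<^sub>\<le>\<^sub>0)" by (intro holomorphic_on_Ln) auto
  then have "Ln_deriv q holomorphic_on (- \<real>\<^sub>\<le>\<^sub>0)" by (rule holomorphic_higher_deriv) (rule op)
  with op assms show ?thesis by (auto intro: holomorphic_derivI)
qed

lemma Ln_deriv_Suc:
  assumes "z \<notin> \<real>\<^sub>\<le>\<^sub>0"
  shows "Ln_deriv (Suc q) z = (-1) ^ q * fact q / z ^ Suc q"
  using assms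
proof (induction q arbitrary: z)
  case 0
  have "(Ln has_field_derivative inverse z) (at z)"
    using 0 by (intro has_field_derivative_Ln) auto
  then show ?case by (simp add: DERIV_imp_deriv field_simps)
next
  case (Suc q)
  then have z: "z \<noteq> 0" by auto
  have op: "open (- \<real>\<^sub>\<le>\<^sub>0 :: complex set)" by (intro open_Compl) simp
  have "((\<lambda>z. z ^ Suc q) has_field_derivative of_nat (Suc q) * z ^ q) (at z)"
    by (rule derivative_eq_intros refl | simp del: power_Suc)+
  from DERIV_divide[OF DERIV_const this, of "(-1) ^ q * fact q"] z
  have "((\<lambda>z. (-1) ^ q * fact q / z ^ Suc q) has_field_derivative
      (0 * z ^ Suc q - (-1) ^ q * fact q * (of_nat (Suc q) * z ^ q)) / (z ^ Suc q * z ^ Suc q)) (at z)"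
    by simp
  moreover have "(0 * z ^ Suc q - (-1) ^ q * fact q * (of_nat (Suc q) * z ^ q)) / (z ^ Suc q * z ^ Suc q)
      = (-1) ^ Suc q * fact (Suc q) / z ^ Suc (Suc q)"
    using z by (simp add: field_simps)
  ultimately have "((\<lambda>z. (-1) ^ q * fact q / z ^ Suc q) has_field_derivative
      (-1) ^ Suc q * fact (Suc q) / z ^ Suc (Suc q)) (at z)"
    by metis
  moreover have "\<forall>\<^sub>F w in nhds z. Ln_deriv (Suc q) w = (-1) ^ q * fact q / w ^ Suc q"
  proof (rule eventually_mono)
    show "\<forall>\<^sub>F w in nhds z. w \<in> - \<real>\<^sub>\<le>\<^sub>0"
      using Suc.prems by (intro eventually_nhds_in_open[OF op]) simp
  qed (rule Suc.IH, simp)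
  ultimately have "(Ln_deriv (Suc q) has_field_derivative (-1) ^ Suc q * fact (Suc q) / z ^ Suc (Suc q)) (at z)"
    by (subst DERIV_cong_ev[OF refl _ refl]) auto
  with has_field_derivative_Ln_deriv[OF Suc.prems, of "Suc q"] show ?case
    by (rule DERIV_unique)
qed

lemma right_half_plane_not_nonpos_Reals: "0 < Re z \<Longrightarrow> z \<notin> \<real>\<^sub>\<le>\<^sub>0"
  by (auto simp: complex_nonpos_Reals_iff)

text \<open>
  For \<open>q = 0\<close> this is Frullani's integral. In every order, the difference on the right is, up to sign,
  the integral over \<open>u \<in> [c, d]\<close> of the derivative of order \<open>q + 1\<close> at \<open>w + u\<close>, a negative power of
  \<open>w + u\<close> and hence a Laplace integral in \<open>s\<close>; Fubini's theorem then carries out the integration in \<open>u\<close> first.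
\<close>
lemma laplace_Ln_deriv_diff_le:
  fixes c d :: real
  assumes w: "0 < Re w" and cd: "0 \<le> c" "c \<le> d"
  shows "has_bochner_integral lborel
           (\<lambda>s::real. indicator {0<..} s *\<^sub>R
              (of_real (s ^ q * ((exp (- s * c) - exp (- s * d)) / s)) * exp (- of_real s * w)))
           ((-1) ^ Suc q * (Ln_deriv q (w + of_real c) - Ln_deriv q (w + of_real d)))"
proof -
  define k where "k = (\<lambda>(u::real) (s::real). indicator {c..d} u *\<^sub>R indicator {0<..} s *\<^sub>R
     (of_real (s ^ q) * exp (- of_real s * (w + of_real u))))"
  have k_meas [measurable]: "(\<lambda>(u, s). k u s) \<in> borel_measurable (lborel \<Otimes>\<^sub>M lborel)"
    unfolding k_def by measurable
  have inner: "has_bochner_integral lborel (k u)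
     (indicator {c..d} u *\<^sub>R (fact q / (w + of_real u) ^ Suc q))" for u
  proof (cases "u \<in> {c..d}")
    case True
    then have "0 < Re (w + of_real u)" using w cd by auto
    from laplace_power[OF this, of q] show ?thesis
      using True by (simp add: k_def[abs_def])
  next
    case False
    then show ?thesis by (simp add: k_def[abs_def] has_bochner_integral_zero)
  qed
  have int: "integrable (lborel \<Otimes>\<^sub>M lborel) (\<lambda>(u, s). k u s)"
  proof (rule Bochner_Integration.integrable_bound)
    show "integrable (lborel \<Otimes>\<^sub>M lborel)
       (\<lambda>(u::real, s::real). indicator {c..d} u * (indicator {0<..} s *\<^sub>R (s ^ q * exp (- s * Re w))))"
    proof (rule lborel_pair.Fubini_integrable)
      show "AE u in lborel. integrable lborel (\<lambda>s. case (u, s) of (u, s) \<Rightarrow>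
         indicator {c..d} u * (indicator {0<..} s *\<^sub>R (s ^ q * exp (- s * Re w))))"
        using integrable_power_exp[OF w, of q] by (auto intro!: AE_I2 integrable_mult_right)
      show "integrable lborel (\<lambda>u::real. LINT s|lborel. norm (case (u, s) of (u, s) \<Rightarrow>
         indicator {c..d} u * (indicator {0<..} s *\<^sub>R (s ^ q * exp (- s * Re w)))))"
        using cd by (simp add: abs_mult integrable_indicator_iff)
    qed measurable
    show "AE x in lborel \<Otimes>\<^sub>M lborel. norm (case x of (u, s) \<Rightarrow> k u s) \<le>
      norm (case x of (u, s) \<Rightarrow> indicator {c..d} u * (indicator {0<..} s *\<^sub>R (s ^ q * exp (- s * Re w))))"
      using cd by (intro AE_I2)
        (auto simp: k_def indicator_def norm_mult norm_power intro!: mult_left_mono mult_nonneg_nonneg)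
  qed simp
  have left: "(LINT u|lborel. LINT s|lborel. k u s) =
     (-1) ^ Suc q * (Ln_deriv q (w + of_real c) - Ln_deriv q (w + of_real d))"
  proof -
    have "(LINT u|lborel. indicator {c..d} u *\<^sub>R (fact q / (w + of_real u) ^ Suc q)) =
       (-1) ^ q * Ln_deriv q (w + of_real d) - (-1) ^ q * Ln_deriv q (w + of_real c)"
    proof (rule integral_FTC_Icc[OF \<open>c \<le> d\<close>])
      fix u :: real assume u: "c \<le> u" "u \<le> d"
      then have pos: "0 < Re (w + of_real u)" using w cd by auto
      have "((\<lambda>v. Ln_deriv q (w + v)) has_field_derivative Ln_deriv (Suc q) (w + of_real u)) (at (of_real u))"
        using has_field_derivative_Ln_deriv[OF right_half_plane_not_nonpos_Reals[OF pos], of q]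
        using DERIV_shift[of "Ln_deriv q" _ "of_real u" w] by (simp add: add.commute del: funpow.simps)
      then have "((\<lambda>v. (-1) ^ q * Ln_deriv q (w + v)) has_field_derivative
          (-1) ^ q * ((-1) ^ q * fact q / (w + of_real u) ^ Suc q)) (at (of_real u))"
        unfolding Ln_deriv_Suc[OF right_half_plane_not_nonpos_Reals[OF pos], symmetric]
        by (rule DERIV_cmult)
      moreover have "(-1) ^ q * ((-1) ^ q * fact q / (w + of_real u) ^ Suc q) = fact q / (w + of_real u) ^ Suc q"
        by (simp flip: power_mult_distrib mult.assoc)
      ultimately have "((\<lambda>v. (-1) ^ q * Ln_deriv q (w + v)) has_field_derivative
          fact q / (w + of_real u) ^ Suc q) (at (of_real u))" by metis
      then show "((\<lambda>u. (-1) ^ q * Ln_deriv q (w + of_real u)) has_vector_derivative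
          fact q / (w + of_real u) ^ Suc q) (at u within {c..d})"
        by (rule has_vector_derivative_real_field)
    next
      have "w + of_real u \<noteq> 0" if "u \<in> {c..d}" for u :: real
        using that w cd by (auto simp: complex_eq_iff)
      then show "continuous_on {c..d} (\<lambda>u. fact q / (w + of_real u) ^ Suc q)"
        by (intro continuous_intros) auto
    qed
    then show ?thesis
      using inner by (simp add: has_bochner_integral_iff algebra_simps)
  qed
  have right: "(LINT u|lborel. k u s) = indicator {0<..} s *\<^sub>R
       (of_real (s ^ q * ((exp (- s * c) - exp (- s * d)) / s)) * exp (- of_real s * w))" for s
  proof (cases "0 < s")
    case True
    have "(LINT u|lborel. indicator {c..d} u *\<^sub>R exp (- of_real s * (w + of_real u))) =
       - exp (- of_real s * (w + of_real d)) / of_real s - - exp (- of_real s * (w + of_real c)) / of_real s"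
      using True by (intro integral_FTC_Icc[OF \<open>c \<le> d\<close>] has_vector_derivative_real_field)
        (auto intro!: derivative_eq_intros continuous_intros)
    also have "\<dots> = exp (- of_real s * w) * of_real ((exp (- s * c) - exp (- s * d)) / s)"
    proof -
      have "exp (- of_real s * (w + of_real v)) = exp (- of_real s * w) * of_real (exp (- s * v))" for v
        by (simp add: distrib_left exp_diff exp_minus divide_inverse exp_of_real flip: of_real_mult)
      then show ?thesis by (simp add: diff_divide_distrib right_diff_distrib)
    qed
    finally have "(LINT u|lborel. of_real (s ^ q) * (indicator {c..d} u *\<^sub>R exp (- of_real s * (w + of_real u)))) =
       of_real (s ^ q * ((exp (- s * c) - exp (- s * d)) / s)) * exp (- of_real s * w)"
      by (subst integral_mult_right_zero) (simp add: mult_ac)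
    moreover have "k u s = of_real (s ^ q) * (indicator {c..d} u *\<^sub>R exp (- of_real s * (w + of_real u)))" for u
      using True by (simp add: k_def)
    ultimately show ?thesis using True by simp
  qed (simp add: k_def)
  from lborel_pair.Fubini_integral[OF int] lborel_pair.integrable_snd[OF int]
  show ?thesis by (simp add: has_bochner_integral_iff left right)
qed

lemma laplace_Ln_deriv_diff:
  fixes c d :: real
  assumes w: "0 < Re w" and "0 \<le> c" "0 \<le> d"
  shows "has_bochner_integral lborel
           (\<lambda>s::real. indicator {0<..} s *\<^sub>R
              (of_real (s ^ q * ((exp (- s * c) - exp (- s * d)) / s)) * exp (- of_real s * w)))
           ((-1) ^ Suc q * (Ln_deriv q (w + of_real c) - Ln_deriv q (w + of_real d)))"
proof (cases "c \<le> d")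
  case True
  then show ?thesis using assms by (intro laplace_Ln_deriv_diff_le)
next
  case False
  then have "has_bochner_integral lborel
           (\<lambda>s::real. - (indicator {0<..} s *\<^sub>R
              (of_real (s ^ q * ((exp (- s * d) - exp (- s * c)) / s)) * exp (- of_real s * w))))
           (- ((-1) ^ Suc q * (Ln_deriv q (w + of_real d) - Ln_deriv q (w + of_real c))))"
    using assms by (intro has_bochner_integral_minus laplace_Ln_deriv_diff_le) auto
  then show ?thesis by (simp add: algebra_simps diff_divide_distrib)
qed

section \<open>Polynomials under equal power sums\<close>

text \<open>In the expansion of \<open>R (z + t)\<close> in powers of \<open>t\<close>, only exponents up to the degree of \<open>R\<close> occur.\<close>
lemma sum_poly_shift_eq:
  fixes R :: "complex poly"
  assumes "degree R \<le> l"
    and "\<And>j. j \<le> l \<Longrightarrow> (\<Sum>k\<in>K. x k ^ j) = (\<Sum>k\<in>K. y k ^ j)"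
  shows "(\<Sum>k\<in>K. poly R (z + x k)) = (\<Sum>k\<in>K. poly R (z + y k))"
proof -
  define S where "S = R \<circ>\<^sub>p [:z, 1:]"
  have "degree S \<le> l" unfolding S_def using degree_pcompose_le[of R "[:z, 1:]"] assms(1) by simp
  then have S: "poly R (z + t) = (\<Sum>j\<le>l. coeff S j * t ^ j)" for t
  proof -
    have "poly R (z + t) = poly S t" by (simp add: S_def poly_pcompose)
    also have "\<dots> = (\<Sum>j\<le>l. coeff S j * t ^ j)"
      unfolding poly_altdef using \<open>degree S \<le> l\<close>
      by (intro sum.mono_neutral_left) (auto simp: coeff_eq_0)
    finally show ?thesis .
  qed
  have "(\<Sum>k\<in>K. poly R (z + x k)) = (\<Sum>j\<le>l. coeff S j * (\<Sum>k\<in>K. x k ^ j))" for x :: "'a \<Rightarrow> complex"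
    unfolding S by (subst sum.swap) (simp add: sum_distrib_left)
  then show ?thesis using assms(2) by simp
qed

lemma degree_funpow_pderiv_le: "degree ((pderiv ^^ q) R) \<le> degree R - q"
  for R :: "complex poly"
  by (induction q) (auto simp: degree_pderiv intro: order.trans)

section \<open>Order of the zeros of a Hadamard product\<close>

text \<open>
  The polynomial in the elementary factor cancels the initial part of the logarithmic series; the
  remaining tail is compared with a geometric series.
\<close>
lemma norm_log_weierstrass_factor_le:
  fixes z :: complex
  assumes "norm z \<le> 1 / 2"
  shows "norm (Ln (1 - z) + (\<Sum>j=1..d. z ^ j / of_nat j)) \<le> 2 * norm z ^ Suc d"
proof -
  have lt: "norm z < 1" using assms by simp
  have "(\<lambda>j. - (z ^ j / of_nat j)) sums Ln (1 - z)"
    using Ln_series'[of "- z"] lt by simp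
  moreover have "(\<Sum>j<Suc d. - (z ^ j / of_nat j)) = - (\<Sum>j=1..d. z ^ j / of_nat j)"
    by (subst sum.lessThan_Suc_shift) (simp add: sum_negf sum.atLeast1_atMost_eq)
  ultimately have tail: "(\<lambda>j. - (z ^ (j + Suc d) / of_nat (j + Suc d))) sums
      (Ln (1 - z) + (\<Sum>j=1..d. z ^ j / of_nat j))"
    by (subst sums_iff_shift) simp
  have geom: "(\<lambda>j. norm z ^ Suc d * norm z ^ j) sums (norm z ^ Suc d * (1 / (1 - norm z)))"
    using lt by (intro sums_mult geometric_sums) simp
  have "norm (Ln (1 - z) + (\<Sum>j=1..d. z ^ j / of_nat j)) \<le> norm z ^ Suc d * (1 / (1 - norm z))"
  proof (rule norm_sums_le[OF tail geom])
    fix j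
    have "norm (- (z ^ (j + Suc d) / of_nat (j + Suc d))) = norm z ^ Suc d * norm z ^ j / real (j + Suc d)"
      by (simp only: power_add norm_minus_cancel norm_divide norm_of_nat norm_power norm_mult mult.commute)
    also have "\<dots> \<le> norm z ^ Suc d * norm z ^ j / 1"
      by (intro divide_left_mono mult_nonneg_nonneg) auto
    finally show "norm (- (z ^ (j + Suc d) / of_nat (j + Suc d))) \<le> norm z ^ Suc d * norm z ^ j" by simp
  qed
  also have "\<dots> \<le> norm z ^ Suc d * 2"
    using assms by (intro mult_left_mono) (auto simp: field_simps)
  finally show ?thesis by (simp add: mult.commute)
qed

text \<open>
  The factorization from Hadamard's theorem. The index set \<open>I\<close> may be finite or infinite, and indices
  outside \<open>I\<close> stand for the factor \<open>1\<close>, so that all products and sums run over \<open>nat\<close>.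
\<close>
locale hadamard_product =
  fixes f :: "complex \<Rightarrow> complex" and r :: nat and Q :: "complex poly" and d :: nat
    and I :: "nat set" and c :: "nat \<Rightarrow> complex"
  assumes c_nonzero: "k \<in> I \<Longrightarrow> c k \<noteq> 0"
    and summable_c: "summable (\<lambda>k. if k \<in> I then 1 / norm (c k) ^ Suc d else 0)"
    and has_product: "\<exists>P. (\<lambda>k. if k \<in> I then weierstrass_factor d (z / c k) else 1) has_prod P \<and>
                 f z = z ^ r * exp (poly Q z) * P"
begin

definition log_factor :: "nat \<Rightarrow> complex \<Rightarrow> complex" where
  "log_factor k z = (if k \<in> I then Ln (1 - z / c k) + (\<Sum>j=1..d. (z / c k) ^ j / of_nat j) else 0)"

text \<open>
  On the disc of radius \<open>R\<close> the logarithms of all but finitely many factors are holomorphic with a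
  summable bound: those whose zero lies outside the disc of radius \<open>2 * R\<close>. The exceptional factors are kept as
  factors.
\<close>
definition near :: "real \<Rightarrow> nat set" where
  "near R = {k \<in> I. norm (c k) \<le> 2 * R}"

definition far_log_factor :: "real \<Rightarrow> nat \<Rightarrow> complex \<Rightarrow> complex" where
  "far_log_factor R k z = (if k \<in> near R then 0 else log_factor k z)"

lemma finite_near [simp]: "finite (near R)"
proof -
  \<comment> \<open>The \<open>1\<close> keeps the denominator positive for every \<open>R\<close>.\<close>
  define e where "e = 1 / (2 * \<bar>R\<bar> + 1) ^ Suc d"
  have "e > 0" by (simp add: e_def)
  from tendstoD[OF summable_LIMSEQ_zero[OF summable_c] this]
  have "\<forall>\<^sub>F k in sequentially. norm ((if k \<in> I then 1 / norm (c k) ^ Suc d else 0) - 0) < e"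
    unfolding dist_norm .
  then obtain K where K: "\<And>k. k \<ge> K \<Longrightarrow> k \<in> I \<Longrightarrow> 1 / norm (c k) ^ Suc d < e"
    unfolding eventually_sequentially by (auto split: if_splits)
  have "near R \<subseteq> {..<K}"
  proof (rule subsetI, rule ccontr)
    fix k assume k: "k \<in> near R" "k \<notin> {..<K}"
    then have "norm (c k) \<le> 2 * \<bar>R\<bar> + 1" and kI: "k \<in> I" by (auto simp: near_def)
    then have "norm (c k) ^ Suc d \<le> (2 * \<bar>R\<bar> + 1) ^ Suc d" by (intro power_mono) auto
    then have "e \<le> 1 / norm (c k) ^ Suc d"
      unfolding e_def using c_nonzero[OF kI] by (intro divide_left_mono mult_pos_pos) (auto intro!: zero_less_power)
    with K[of k] k kI show False by auto
  qed
  then show ?thesis by (rule finite_subset) simp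
qed

lemma norm_log_factor_le:
  assumes "norm z \<le> R" "k \<notin> near R"
  shows "norm (log_factor k z) \<le> 2 * R ^ Suc d * (if k \<in> I then 1 / norm (c k) ^ Suc d else 0)"
proof (cases "k \<in> I")
  case True
  then have c: "norm (c k) > 2 * R" "norm (c k) > 0" using assms c_nonzero by (auto simp: near_def)
  then have "norm (z / c k) \<le> 1 / 2" using assms by (simp add: norm_divide field_simps)
  then have "norm (log_factor k z) \<le> 2 * norm (z / c k) ^ Suc d"
    unfolding log_factor_def using True by (simp only: if_True norm_log_weierstrass_factor_le)
  also have "\<dots> \<le> 2 * (R / norm (c k)) ^ Suc d"
    using assms c by (intro mult_left_mono power_mono) (auto simp: norm_divide divide_right_mono)
  finally show ?thesis using True by (simp add: power_divide)
qed (simp add: log_factor_def)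

lemma uniform_limit_log_factors:
  "uniform_limit (cball 0 R) (\<lambda>n z. \<Sum>k<n. log_factor k z) (\<lambda>z. \<Sum>k. log_factor k z) sequentially"
proof (rule Weierstrass_m_test_ev)
  obtain K where K: "near R \<subseteq> {..<K}" using finite_nat_iff_bounded finite_near by blast
  show "\<forall>\<^sub>F k in sequentially. \<forall>z\<in>cball 0 R. norm (log_factor k z)
      \<le> 2 * R ^ Suc d * (if k \<in> I then 1 / norm (c k) ^ Suc d else 0)"
    using eventually_ge_at_top[of K]
  proof eventually_elim
    case (elim k)
    then have "k \<notin> near R" using K by auto
    then show ?case by (intro ballI norm_log_factor_le) simp_all
  qed
qed (intro summable_mult summable_c)

lemma uniform_limit_far_log_factors:
  assumes "0 \<le> R"
  shows "uniform_limit (cball 0 R) (\<lambda>n z. \<Sum>k<n. far_log_factor R k z) (\<lambda>z. \<Sum>k. far_log_factor R k z) sequentially"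
proof (rule Weierstrass_m_test_ev)
  show "\<forall>\<^sub>F k in sequentially. \<forall>z\<in>cball 0 R. norm (far_log_factor R k z)
      \<le> 2 * R ^ Suc d * (if k \<in> I then 1 / norm (c k) ^ Suc d else 0)"
  proof (intro always_eventually allI ballI)
    fix k and z :: complex assume z: "z \<in> cball 0 R"
    show "norm (far_log_factor R k z) \<le> 2 * R ^ Suc d * (if k \<in> I then 1 / norm (c k) ^ Suc d else 0)"
    proof (cases "k \<in> near R")
      case False
      with z show ?thesis unfolding far_log_factor_def if_not_P[OF False] by (intro norm_log_factor_le) simp_all
    qed (use assms in \<open>simp add: far_log_factor_def\<close>)
  qed
qed (intro summable_mult summable_c)

lemma exp_log_factor:
  assumes "k \<in> I \<Longrightarrow> z \<noteq> c k"
  shows "exp (log_factor k z) = (if k \<in> I then weierstrass_factor d (z / c k) else 1)"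
proof -
  have "1 - z / c k \<noteq> 0" if "k \<in> I" using assms[OF that] c_nonzero[OF that] by simp
  then show ?thesis by (simp add: log_factor_def weierstrass_factor_def exp_add)
qed

lemma eq_if_product_tendsto:
  assumes "(\<lambda>n. \<Prod>k<n. if k \<in> I then weierstrass_factor d (z / c k) else 1) \<longlonglongrightarrow> P"
  shows "f z = z ^ r * exp (poly Q z) * P"
proof -
  obtain P' where P': "(\<lambda>k. if k \<in> I then weierstrass_factor d (z / c k) else 1) has_prod P'"
    "f z = z ^ r * exp (poly Q z) * P'" using has_product by blast
  from has_prod_imp_tendsto'[OF P'(1)] assms have "P' = P" by (rule LIMSEQ_unique)
  with P' show ?thesis by simp
qed

text \<open>
  On a disc, \<open>f\<close> is a finite product, which carries its zeros there, times the exponential of a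
  holomorphic function.
\<close>
lemma factorization:
  assumes z: "norm z \<le> R"
  shows "f z = z ^ r * exp (poly Q z) *
    ((\<Prod>k\<in>near R. weierstrass_factor d (z / c k)) * exp (\<Sum>k. far_log_factor R k z))"
proof (rule eq_if_product_tendsto)
  have R: "0 \<le> R" using z norm_ge_zero order_trans by blast
  obtain K where K: "near R \<subseteq> {..<K}" using finite_nat_iff_bounded finite_near by blast
  have "(\<lambda>n. \<Sum>k<n. far_log_factor R k z) \<longlonglongrightarrow> (\<Sum>k. far_log_factor R k z)"
    by (rule tendsto_uniform_limitI[OF uniform_limit_far_log_factors[OF R]]) (use z in simp)
  then have "(\<lambda>n. (\<Prod>k\<in>near R. weierstrass_factor d (z / c k)) * exp (\<Sum>k<n. far_log_factor R k z))
     \<longlonglongrightarrow> (\<Prod>k\<in>near R. weierstrass_factor d (z / c k)) * exp (\<Sum>k. far_log_factor R k z)"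
    by (intro tendsto_intros)
  moreover have "\<forall>\<^sub>F n in sequentially.
     (\<Prod>k\<in>near R. weierstrass_factor d (z / c k)) * exp (\<Sum>k<n. far_log_factor R k z) =
     (\<Prod>k<n. if k \<in> I then weierstrass_factor d (z / c k) else 1)"
    using eventually_ge_at_top[of K]
  proof eventually_elim
    case (elim n)
    have "(\<Prod>k\<in>near R. weierstrass_factor d (z / c k)) =
        (\<Prod>k<n. if k \<in> near R then weierstrass_factor d (z / c k) else 1)"
      using K elim by (intro prod.mono_neutral_cong_left) auto
    moreover have "exp (\<Sum>k<n. far_log_factor R k z) = (\<Prod>k<n. exp (far_log_factor R k z))"
      by (rule exp_sum) simp
    moreover have "(if k \<in> near R then weierstrass_factor d (z / c k) else 1) * exp (far_log_factor R k z) =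
        (if k \<in> I then weierstrass_factor d (z / c k) else 1)" for k
    proof (cases "k \<in> near R")
      case False
      then have "z \<noteq> c k" if "k \<in> I" using that z R c_nonzero[OF that] by (auto simp: near_def)
      with False show ?thesis by (simp add: far_log_factor_def exp_log_factor)
    qed (simp add: far_log_factor_def near_def)
    ultimately show ?case by (simp flip: prod.distrib)
  qed
  ultimately show "(\<lambda>n. \<Prod>k<n. if k \<in> I then weierstrass_factor d (z / c k) else 1) \<longlonglongrightarrow>
     (\<Prod>k\<in>near R. weierstrass_factor d (z / c k)) * exp (\<Sum>k. far_log_factor R k z)"
    by (rule Lim_transform_eventually)
qed

lemma f_c_eq_0: "k \<in> I \<Longrightarrow> f (c k) = 0"
proof -
  assume k: "k \<in> I"
  then have "k \<in> near (norm (c k))" "weierstrass_factor d (c k / c k) = 0"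
    using c_nonzero by (auto simp: near_def)
  then have "(\<Prod>i\<in>near (norm (c k)). weierstrass_factor d (c k / c i)) = 0"
    by (intro prod_zero bexI[of _ k]) simp_all
  with factorization[of "c k" "norm (c k)"] show ?thesis by simp
qed

lemma finite_fibre: "finite {k \<in> I. c k = z}"
  by (rule finite_subset[OF _ finite_near[of "norm z"]]) (auto simp: near_def)

lemma far_log_sum_holomorphic:
  assumes "0 \<le> R"
  shows "(\<lambda>z. \<Sum>k. far_log_factor R k z) holomorphic_on ball 0 R"
proof (rule holomorphic_uniform_sequence[of _ "\<lambda>n z. \<Sum>k<n. far_log_factor R k z"])
  have "far_log_factor R k holomorphic_on ball 0 R" for k
  proof (cases "k \<in> I \<and> k \<notin> near R")
    case True
    have "1 - z / c k \<notin> \<real>\<^sub>\<le>\<^sub>0" if "z \<in> ball 0 R" for z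
    proof -
      have "norm (z / c k) < 1"
        using that True c_nonzero[of k] norm_ge_zero[of z] unfolding near_def
        by (auto simp: norm_divide simp del: norm_ge_zero)
      then have "Re (z / c k) < 1" using complex_Re_le_cmod[of "z / c k"] by linarith
      then show ?thesis by (auto simp: complex_nonpos_Reals_iff)
    qed
    then have "(\<lambda>z. Ln (1 - z / c k) + (\<Sum>j=1..d. (z / c k) ^ j / of_nat j)) holomorphic_on ball 0 R"
      using True c_nonzero by (intro holomorphic_intros) auto
    then show ?thesis using True by (simp add: far_log_factor_def[abs_def] log_factor_def)
  next
    case False
    then have "far_log_factor R k = (\<lambda>z. 0)" by (auto simp: fun_eq_iff far_log_factor_def log_factor_def)
    then show ?thesis by simp
  qed
  then show "(\<lambda>z. \<Sum>k<n. far_log_factor R k z) holomorphic_on ball 0 R" for n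
    by (intro holomorphic_intros)
  fix z :: complex assume "z \<in> ball 0 R"
  then obtain e where "e > 0" "cball z e \<subseteq> ball 0 R" by (meson open_ball open_contains_cball)
  then show "\<exists>e>0. cball z e \<subseteq> ball 0 R \<and> uniform_limit (cball z e)
      (\<lambda>n z. \<Sum>k<n. far_log_factor R k z) (\<lambda>z. \<Sum>k. far_log_factor R k z) sequentially"
    by (intro exI[of _ e] conjI uniform_limit_on_subset[OF uniform_limit_far_log_factors[OF assms]])
       (auto dest: ball_subset_cball[THEN subsetD])
qed simp

text \<open>
  In the local factorization, each factor with \<open>c k = z0\<close> contributes one power of \<open>z - z0\<close> and the
  constant \<open>- 1 / z0\<close>; what remains does not vanish at \<open>z0\<close>.
\<close>
lemma zorder_eq_card:
  "zorder f z0 = int ((if z0 = 0 then r else 0) + card {k \<in> I. c k = z0})"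
proof -
  define R where "R = norm z0 + 1"
  define K where "K = {k \<in> I. c k = z0}"
  \<comment> \<open>For \<open>z0 = 0\<close> the set \<open>K\<close> is empty, and \<open>z ^ r\<close> is the power of \<open>z - z0\<close> to be split off.\<close>
  define U where "U = (\<lambda>z. (if z0 = 0 then 1 else z ^ r) * exp (poly Q z) *
     ((\<Prod>k\<in>near R - K. weierstrass_factor d (z / c k)) *
      (\<Prod>k\<in>K. (- 1 / z0) * exp (\<Sum>j=1..d. (z / z0) ^ j / of_nat j)) * exp (\<Sum>k. far_log_factor R k z)))"
  have R: "0 \<le> R" by (simp add: R_def)
  have K: "K \<subseteq> near R" by (auto simp: K_def near_def R_def)
  have finK: "finite K" using finite_fibre by (simp add: K_def)
  have K0: "K = {}" if "z0 = 0" using that c_nonzero by (auto simp: K_def)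
  show ?thesis
  proof (rule zorder_eqI)
    have 1: "(\<lambda>z. \<Prod>k\<in>near R - K. weierstrass_factor d (z / c k)) holomorphic_on ball 0 R"
      using c_nonzero by (intro holomorphic_intros) (auto simp: near_def)
    have 2: "(\<lambda>z. if z0 = 0 then 1 else z ^ r) holomorphic_on ball 0 R"
      by (cases "z0 = 0") (auto intro!: holomorphic_intros)
    have 3: "(\<lambda>z. \<Prod>k\<in>K. (- 1 / z0) * exp (\<Sum>j=1..d. (z / z0) ^ j / of_nat j)) holomorphic_on ball 0 R"
      using K0 by (cases "z0 = 0") (auto intro!: holomorphic_intros)
    have 4: "(\<lambda>z. exp (poly Q z)) holomorphic_on ball 0 R"
      by (intro holomorphic_intros)
    have 5: "(\<lambda>z. exp (\<Sum>k. far_log_factor R k z)) holomorphic_on ball 0 R"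
      by (intro holomorphic_on_exp' far_log_sum_holomorphic[OF R])
    show "U holomorphic_on ball 0 R"
      unfolding U_def by (rule 1 2 3 4 5 holomorphic_on_mult)+
    have "weierstrass_factor d (z0 / c k) \<noteq> 0" if "k \<in> near R - K" for k
      using that c_nonzero[of k] by (auto simp: near_def K_def)
    then show "U z0 \<noteq> 0"
      unfolding U_def using K0 finK by (auto simp: prod_zero_iff)
    fix z :: complex assume z: "z \<in> ball 0 R"
    have "(\<Prod>k\<in>near R. weierstrass_factor d (z / c k)) =
       (\<Prod>k\<in>near R - K. weierstrass_factor d (z / c k)) * (\<Prod>k\<in>K. weierstrass_factor d (z / c k))"
      by (rule prod.subset_diff[OF K finite_near])
    also have "(\<Prod>k\<in>K. weierstrass_factor d (z / c k)) =
       (\<Prod>k\<in>K. ((- 1 / z0) * exp (\<Sum>j=1..d. (z / z0) ^ j / of_nat j)) * (z - z0))"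
    proof (rule prod.cong[OF refl])
      fix k assume k: "k \<in> K"
      then have "c k = z0" "z0 \<noteq> 0" using K0 by (auto simp: K_def)
      then show "weierstrass_factor d (z / c k) = ((- 1 / z0) * exp (\<Sum>j=1..d. (z / z0) ^ j / of_nat j)) * (z - z0)"
        by (simp add: weierstrass_factor_def field_simps)
    qed
    also have "\<dots> = (\<Prod>k\<in>K. (- 1 / z0) * exp (\<Sum>j=1..d. (z / z0) ^ j / of_nat j)) * (z - z0) ^ card K"
      by (simp only: prod.distrib prod_constant)
    finally have "f z = U z * (z - z0) ^ ((if z0 = 0 then r else 0) + card K)"
      using factorization[of z R] z by (simp add: U_def power_add)
    then show "f z = U z * (z - z0) powi int ((if z0 = 0 then r else 0) + card {k \<in> I. c k = z0})"
      by (simp only: power_int_of_nat K_def)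
  qed (auto simp: R_def)
qed

end

section \<open>The logarithm of a Hadamard product on the slit plane\<close>

text \<open>The values lie in \<open>2 * pi * \<i> * \<int>\<close>, where distinct points have distance at least \<open>2 * pi\<close>.\<close>
lemma exp_eq_1_connected_imp_constant:
  fixes D :: "'a :: topological_space \<Rightarrow> complex"
  assumes "connected S" "continuous_on S D" "\<And>x. x \<in> S \<Longrightarrow> exp (D x) = 1"
    and "x \<in> S" "y \<in> S"
  shows "D x = D y"
proof -
  have "D constant_on S"
  proof (rule continuous_discrete_range_constant[OF assms(1,2)])
    fix x assume x: "x \<in> S"
    have "2 * pi \<le> norm (D y - D x)" if y: "y \<in> S" "D y \<noteq> D x" for y
    proof -
      from assms(3)[OF x] assms(3)[OF y(1)] obtain m n :: int
        where mn: "D x = of_int (2 * m) * of_real pi * \<i>" "D y = of_int (2 * n) * of_real pi * \<i>"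
        unfolding exp_eq_1 by (auto simp: complex_eq_iff)
      then have "m \<noteq> n" using y by auto
      then have "1 \<le> \<bar>of_int (n - m) :: real\<bar>" by (simp flip: of_int_diff of_int_abs)
      moreover have "D y - D x = of_real (2 * pi * of_int (n - m)) * \<i>"
        by (simp add: mn algebra_simps)
      ultimately have "norm (D y - D x) = 2 * pi * \<bar>of_int (n - m) :: real\<bar>"
        by (simp only: norm_mult norm_of_real abs_mult norm_ii) simp
      then show ?thesis using \<open>1 \<le> \<bar>of_int (n - m) :: real\<bar>\<close> by simp
    qed
    then show "\<exists>e>0. \<forall>y. y \<in> S \<and> D y \<noteq> D x \<longrightarrow> e \<le> norm (D y - D x)"
      by (intro exI[of _ "2 * pi"]) auto
  qed
  then show ?thesis using assms(4,5) by (auto simp: constant_on_def)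
qed

lemma uniform_limit_sum:
  fixes f :: "'i \<Rightarrow> 'n \<Rightarrow> 'a \<Rightarrow> 'b :: real_normed_vector"
  assumes "\<And>k. k \<in> K \<Longrightarrow> uniform_limit A (f k) (g k) F"
  shows "uniform_limit A (\<lambda>n x. \<Sum>k\<in>K. f k n x) (\<lambda>x. \<Sum>k\<in>K. g k x) F"
  using assms
  by (induction K rule: infinite_finite_induct) (auto intro!: uniform_limit_intros)

lemma connected_slit_plane: "connected (- \<real>\<^sub>\<le>\<^sub>0 :: complex set)"
proof -
  have "(\<real>\<^sub>\<le>\<^sub>0 :: complex set) = complex_of_real ` {..0}"
    by (auto simp: complex_nonpos_Reals_iff complex_eq_iff image_iff)
  then show ?thesis using starlike_imp_connected[OF starlike_slotted_complex_plane_left[of 0]] by simp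
qed

lemma open_slit_plane: "open (- \<real>\<^sub>\<le>\<^sub>0 :: complex set)"
  by (intro open_Compl) simp

lemma slit_plane_add:
  fixes z :: complex
  assumes "z \<notin> \<real>\<^sub>\<le>\<^sub>0" "0 \<le> x"
  shows "z + of_real x \<notin> \<real>\<^sub>\<le>\<^sub>0"
  using assms by (auto simp: complex_nonpos_Reals_iff)

locale nonpositive_hadamard_product = hadamard_product +
  assumes f_holomorphic: "f holomorphic_on UNIV"
    and zeros: "f z = 0 \<Longrightarrow> Im z = 0 \<and> Re z \<le> 0"
    and f_real: "0 < x \<Longrightarrow> f (of_real x) \<in> \<real>"
    and f_pos: "0 < x \<Longrightarrow> 0 < Re (f (of_real x))"
begin

text \<open>The nonzero zeros are \<open>- \<kappa> k\<close>, \<open>k \<in> I\<close>.\<close>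
definition \<kappa> :: "nat \<Rightarrow> real" where
  "\<kappa> k = - Re (c k)"

lemma c_eq: "k \<in> I \<Longrightarrow> c k = - of_real (\<kappa> k)"
  and \<kappa>_pos: "k \<in> I \<Longrightarrow> 0 < \<kappa> k"
  using zeros[OF f_c_eq_0[of k]] c_nonzero[of k] by (auto simp: \<kappa>_def complex_eq_iff)

definition log_partial :: "nat \<Rightarrow> complex \<Rightarrow> complex" where
  "log_partial n z = of_nat r * Ln z + poly Q z + (\<Sum>k<n. log_factor k z)"

definition log_f :: "complex \<Rightarrow> complex" where
  "log_f z = of_nat r * Ln z + poly Q z + (\<Sum>k. log_factor k z)"

text \<open>
  Everything polynomial in the logarithm of a factor: the exponent of the elementary factor, and the
  constant that turns \<open>Ln (1 - z / c k)\<close> into \<open>Ln (z + \<kappa> k)\<close>.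
\<close>
definition factor_poly :: "nat \<Rightarrow> complex poly" where
  "factor_poly k = (\<Sum>j=1..d. monom (1 / (c k ^ j * of_nat j)) j) - [:of_real (ln (\<kappa> k)):]"

definition partial_poly :: "nat \<Rightarrow> complex poly" where
  "partial_poly n = Q + (\<Sum>k<n. if k \<in> I then factor_poly k else 0)"

lemma degree_partial_poly: "degree (partial_poly n) \<le> max d (degree Q)"
proof -
  have "degree (factor_poly k) \<le> d" for k
    unfolding factor_poly_def
    by (intro degree_diff_le degree_sum_le) (auto intro: order.trans[OF degree_monom_le])
  then have "degree (factor_poly k) \<le> max d (degree Q)" for k
    using le_max_iff_disj by blast
  then show ?thesis unfolding partial_poly_def
    by (intro degree_add_le degree_sum_le) auto
qed

lemma log_factor_slit:
  assumes "k \<in> I" "z \<notin> \<real>\<^sub>\<le>\<^sub>0"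
  shows "log_factor k z = Ln (z + of_real (\<kappa> k)) + poly (factor_poly k) z"
proof -
  have \<kappa>: "0 < \<kappa> k" using assms \<kappa>_pos by blast
  have "z + of_real (\<kappa> k) \<noteq> 0" using slit_plane_add[OF assms(2), of "\<kappa> k"] \<kappa> by auto
  moreover have "1 - z / c k = (z + of_real (\<kappa> k)) / of_real (\<kappa> k)"
    using \<kappa> by (simp add: c_eq[OF assms(1)] field_simps)
  ultimately have "Ln (1 - z / c k) = Ln (z + of_real (\<kappa> k)) - of_real (ln (\<kappa> k))"
    using \<kappa> by (simp add: Ln_divide_of_real)
  then show ?thesis
    using assms by (simp add: log_factor_def factor_poly_def poly_sum poly_monom power_divide)
qed

lemma log_partial_slit:
  assumes "z \<notin> \<real>\<^sub>\<le>\<^sub>0"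
  shows "log_partial n z = of_nat r * Ln z + (\<Sum>k<n. if k \<in> I then Ln (z + of_real (\<kappa> k)) else 0)
     + poly (partial_poly n) z"
proof -
  have "(\<Sum>k<n. log_factor k z) = (\<Sum>k<n. (if k \<in> I then Ln (z + of_real (\<kappa> k)) else 0) +
     poly (if k \<in> I then factor_poly k else 0) z)"
    using assms by (intro sum.cong refl) (simp add: log_factor_slit, simp add: log_factor_def)
  then show ?thesis by (simp add: log_partial_def partial_poly_def sum.distrib poly_sum)
qed

lemma log_partial_holomorphic: "log_partial n holomorphic_on - \<real>\<^sub>\<le>\<^sub>0"
proof -
  have "(\<lambda>z. if k \<in> I then Ln (z + of_real (\<kappa> k)) else 0) holomorphic_on - \<real>\<^sub>\<le>\<^sub>0" for k
    using slit_plane_add \<kappa>_pos[of k]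
    by (cases "k \<in> I") (auto intro!: holomorphic_intros)
  then have "(\<lambda>z. of_nat r * Ln z + (\<Sum>k<n. if k \<in> I then Ln (z + of_real (\<kappa> k)) else 0)
     + poly (partial_poly n) z) holomorphic_on - \<real>\<^sub>\<le>\<^sub>0"
    by (intro holomorphic_intros) auto
  then show ?thesis by (rule holomorphic_transform) (simp add: log_partial_slit)
qed

lemma uniform_limit_log_partial: "uniform_limit (cball 0 R) log_partial log_f sequentially"
  unfolding log_partial_def[abs_def] log_f_def[abs_def]
  by (intro uniform_limit_intros uniform_limit_log_factors)

lemma log_f_holomorphic: "log_f holomorphic_on - \<real>\<^sub>\<le>\<^sub>0"
proof (rule holomorphic_uniform_sequence[of _ log_partial])
  fix z :: complex assume "z \<in> - \<real>\<^sub>\<le>\<^sub>0"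
  then obtain e where e: "e > 0" "cball z e \<subseteq> - \<real>\<^sub>\<le>\<^sub>0" by (meson open_slit_plane open_contains_cball)
  have "cball z e \<subseteq> cball 0 (norm z + e)"
  proof
    fix w assume "w \<in> cball z e"
    then have "norm (w - z) \<le> e" by (simp add: dist_norm norm_minus_commute)
    then show "w \<in> cball 0 (norm z + e)" using norm_triangle_sub[of w z] by simp
  qed
  then have "uniform_limit (cball z e) log_partial log_f sequentially"
    by (rule uniform_limit_on_subset[OF uniform_limit_log_partial])
  with e show "\<exists>e>0. cball z e \<subseteq> - \<real>\<^sub>\<le>\<^sub>0 \<and> uniform_limit (cball z e) log_partial log_f sequentially"
    by blast
qed (intro log_partial_holomorphic open_slit_plane)+

lemma exp_log_f:
  assumes "z \<notin> \<real>\<^sub>\<le>\<^sub>0"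
  shows "exp (log_f z) = f z"
proof -
  have z0: "z \<noteq> 0" using assms by auto
  have zc: "z \<noteq> c k" if "k \<in> I" for k
    using assms \<kappa>_pos[OF that] by (auto simp: c_eq[OF that] complex_nonpos_Reals_iff)
  have "(\<lambda>n. \<Sum>k<n. log_factor k z) \<longlonglongrightarrow> (\<Sum>k. log_factor k z)"
    by (rule tendsto_uniform_limitI[OF uniform_limit_log_factors[of "norm z"]]) simp
  then have "(\<lambda>n. exp (\<Sum>k<n. log_factor k z)) \<longlonglongrightarrow> exp (\<Sum>k. log_factor k z)"
    by (rule tendsto_exp)
  then have "f z = z ^ r * exp (poly Q z) * exp (\<Sum>k. log_factor k z)"
    using zc by (intro eq_if_product_tendsto) (simp add: exp_sum exp_log_factor)
  then show ?thesis using z0 by (simp add: log_f_def exp_add exp_of_nat_mult)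
qed

text \<open>
  The defining property of the branch is satisfiable: \<open>log_f\<close> is a holomorphic logarithm of \<open>f\<close>, and
  subtracting a constant makes it real at \<open>1\<close>, hence, by connectedness, on the positive axis. Any
  function chosen by that property is again a logarithm of \<open>f\<close>, so it differs from \<open>log_f\<close> by a
  constant.
\<close>
lemma log_branch_eq: "\<exists>C. \<forall>z. z \<notin> \<real>\<^sub>\<le>\<^sub>0 \<longrightarrow> log_branch f z = log_f z + C"
proof -
  define L where "L = (\<lambda>z. log_f z - (log_f 1 - of_real (ln (Re (f 1)))))"
  define spec where "spec = (\<lambda>L. L holomorphic_on (- \<real>\<^sub>\<le>\<^sub>0) \<and> (\<forall>z \<in> - \<real>\<^sub>\<le>\<^sub>0. exp (L z) = f z) \<and>
              (\<forall>x::real. x > 0 \<longrightarrow> L (of_real x) \<in> \<real>))"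
  have f_eq: "f (of_real x) = of_real (exp (ln (Re (f (of_real x)))))" if "0 < x" for x
    using f_real[OF that] f_pos[OF that] by simp
  have expL: "exp (L z) = f z" if "z \<notin> \<real>\<^sub>\<le>\<^sub>0" for z
    using that f_eq[of 1] exp_log_f[of z] exp_log_f[of 1] f_pos[of 1]
    by (auto simp: L_def exp_diff exp_of_real)
  have holL: "L holomorphic_on - \<real>\<^sub>\<le>\<^sub>0"
    unfolding L_def by (intro holomorphic_intros log_f_holomorphic)
  have "L (of_real x) \<in> \<real>" if "0 < x" for x
  proof -
    have "L (of_real x) - of_real (ln (Re (f (of_real x)))) = L (of_real 1) - of_real (ln (Re (f (of_real 1))))"
    proof (rule exp_eq_1_connected_imp_constant[of "{0<..}" "\<lambda>x. L (of_real x) - of_real (ln (Re (f (of_real x))))"])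
      have "continuous_on {0<..} (\<lambda>x. L (complex_of_real x))"
        by (rule continuous_on_compose2[OF holomorphic_on_imp_continuous_on[OF holL]])
          (auto intro!: continuous_intros)
      moreover have "continuous_on {0<..} (\<lambda>x. f (complex_of_real x))"
        by (rule continuous_on_compose2[OF holomorphic_on_imp_continuous_on[OF f_holomorphic]])
          (auto intro!: continuous_intros)
      ultimately show "continuous_on {0<..} (\<lambda>x. L (of_real x) - of_real (ln (Re (f (of_real x)))))"
        using f_pos by (force intro!: continuous_intros)
      show "exp (L (of_real x) - of_real (ln (Re (f (of_real x))))) = 1" if "x \<in> {0<..}" for x
      proof -
        have "of_real x \<notin> (\<real>\<^sub>\<le>\<^sub>0 :: complex set)" using that by (auto simp: complex_nonpos_Reals_iff)
        then have "exp (L (of_real x)) = exp (of_real (ln (Re (f (of_real x)))))"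
          using that f_eq[of x] by (simp add: expL exp_of_real)
        then show ?thesis by (simp add: exp_diff)
      qed
    qed (use that in \<open>auto intro!: convex_connected\<close>)
    then show ?thesis by (simp add: L_def)
  qed
  then have "spec L" using expL holL by (auto simp: spec_def)
  then have "spec (log_branch f)"
    using someI[of spec L] by (simp add: log_branch_def spec_def)
  then have lb: "log_branch f holomorphic_on - \<real>\<^sub>\<le>\<^sub>0" "\<And>z. z \<notin> \<real>\<^sub>\<le>\<^sub>0 \<Longrightarrow> exp (log_branch f z) = f z"
    by (auto simp: spec_def)
  have "log_branch f z - log_f z = log_branch f 1 - log_f 1" if "z \<notin> \<real>\<^sub>\<le>\<^sub>0" for z
  proof (rule exp_eq_1_connected_imp_constant[OF connected_slit_plane, of "\<lambda>z. log_branch f z - log_f z"])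
    show "continuous_on (- \<real>\<^sub>\<le>\<^sub>0) (\<lambda>z. log_branch f z - log_f z)"
      by (intro continuous_intros holomorphic_on_imp_continuous_on lb log_f_holomorphic)
    show "exp (log_branch f z - log_f z) = 1" if "z \<in> - \<real>\<^sub>\<le>\<^sub>0" for z
      using that lb(2)[of z] exp_log_f[of z] exp_not_eq_zero[of "log_f z"] by (simp add: exp_diff)
  qed (use that in auto)
  then show ?thesis by (intro exI[of _ "log_branch f 1 - log_f 1"]) (auto simp: algebra_simps)
qed

end

section \<open>Higher derivatives of the logarithm of the quotient\<close>

text \<open>Higher derivatives are read off a sequence of functions each of which differentiates to the next.\<close>
lemma higher_deriv_eqI:
  assumes "open S" "z \<in> S"
    and "\<And>i z. z \<in> S \<Longrightarrow> (E i has_field_derivative E (Suc i) z) (at z)"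
  shows "(deriv ^^ q) (E 0) z = E q z"
  using \<open>z \<in> S\<close>
proof (induction q arbitrary: z)
  case (Suc q)
  have "\<forall>\<^sub>F w in nhds z. (deriv ^^ q) (E 0) w = E q w"
    using eventually_nhds_in_open[OF \<open>open S\<close> Suc.prems] by (auto elim!: eventually_mono intro: Suc.IH)
  then have "deriv ((deriv ^^ q) (E 0)) z = deriv (E q) z" by (rule deriv_cong_ev) simp
  also have "\<dots> = E (Suc q) z" using assms(3)[OF Suc.prems] by (rule DERIV_imp_deriv)
  finally show ?case by simp
qed simp

context nonpositive_hadamard_product
begin

text \<open>
  The derivative of order \<open>i\<close> of \<open>log_partial n\<close> on the slit plane, without the contribution of the
  polynomial \<open>partial_poly n\<close>.
\<close>
definition log_partial_deriv :: "nat \<Rightarrow> nat \<Rightarrow> complex \<Rightarrow> complex" where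
  "log_partial_deriv n i z = of_nat r * Ln_deriv i z +
     (\<Sum>k<n. if k \<in> I then Ln_deriv i (z + of_real (\<kappa> k)) else 0)"

lemma DERIV_log_partial_deriv:
  assumes "z \<notin> \<real>\<^sub>\<le>\<^sub>0"
  shows "(log_partial_deriv n i has_field_derivative log_partial_deriv n (Suc i) z) (at z)"
proof -
  have "((\<lambda>z. if k \<in> I then Ln_deriv i (z + of_real (\<kappa> k)) else 0) has_field_derivative
     (if k \<in> I then Ln_deriv (Suc i) (z + of_real (\<kappa> k)) else 0)) (at z)" for k
  proof (cases "k \<in> I")
    case True
    then show ?thesis
      using has_field_derivative_Ln_deriv[OF slit_plane_add[OF assms, of "\<kappa> k"], of i] \<kappa>_pos[OF True]
      by (simp add: DERIV_shift del: funpow.simps)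
  qed simp
  then show ?thesis
    unfolding log_partial_deriv_def[abs_def]
    by (intro DERIV_add DERIV_cmult DERIV_sum has_field_derivative_Ln_deriv assms)
qed

text \<open>
  Locally uniform limits of holomorphic functions commute with differentiation. The polynomials
  present before the limit have degree at most \<open>l + q\<close>; after \<open>q\<close> derivatives their degree is at
  most \<open>l\<close>, and the equal power sums remove them.
\<close>
lemma tendsto_higher_deriv_log_W:
  fixes a b :: "nat \<Rightarrow> real"
  assumes z: "0 < Re z"
    and nonneg: "\<And>k. k \<in> {1..n} \<Longrightarrow> 0 \<le> a k" "\<And>k. k \<in> {1..n} \<Longrightarrow> 0 \<le> b k"
    and power_sums: "\<And>j. j \<le> l \<Longrightarrow> (\<Sum>k=1..n. a k ^ j) = (\<Sum>k=1..n. b k ^ j)"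
    and degree: "max d (degree Q) \<le> l + q"
  shows "(\<lambda>m. \<Sum>k=1..n. log_partial_deriv m q (z + of_real (a k)) - log_partial_deriv m q (z + of_real (b k)))
     \<longlonglongrightarrow> (deriv ^^ q) (log_W f n a b) z"
proof -
  define H where "H = {z::complex. 0 < Re z}"
  have openH: "open H" unfolding H_def by (rule open_halfspace_Re_gt)
  have shift: "z + of_real x \<in> - \<real>\<^sub>\<le>\<^sub>0" if "z \<in> H" "0 \<le> x" for z x
    using that by (auto simp: H_def complex_nonpos_Reals_iff)
  define G where "G = (\<lambda>m z. \<Sum>k=1..n. log_partial m (z + of_real (a k)) - log_partial m (z + of_real (b k)))"
  define E where "E = (\<lambda>m i z. \<Sum>k=1..n.
     (log_partial_deriv m i (z + of_real (a k)) + poly ((pderiv ^^ i) (partial_poly m)) (z + of_real (a k))) -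
     (log_partial_deriv m i (z + of_real (b k)) + poly ((pderiv ^^ i) (partial_poly m)) (z + of_real (b k))))"
  have derivG: "(deriv ^^ q) (G m) z = (\<Sum>k=1..n. log_partial_deriv m q (z + of_real (a k)) - log_partial_deriv m q (z + of_real (b k)))"
    if z: "z \<in> H" for m z
  proof -
    have "(deriv ^^ q) (G m) z = (deriv ^^ q) (E m 0) z"
    proof (rule higher_deriv_cong_ev[OF _ refl])
      show "\<forall>\<^sub>F w in nhds z. G m w = E m 0 w"
        using eventually_nhds_in_open[OF openH z]
      proof eventually_elim
        case (elim w)
        then have "w + of_real (a k) \<notin> \<real>\<^sub>\<le>\<^sub>0" "w + of_real (b k) \<notin> \<real>\<^sub>\<le>\<^sub>0" if "k \<in> {1..n}" for k
          using shift nonneg[OF that] by blast+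
        then show ?case unfolding G_def E_def
          by (intro sum.cong refl) (simp add: log_partial_slit log_partial_deriv_def cong: if_cong)
      qed
    qed
    also have "\<dots> = E m q z"
    proof (rule higher_deriv_eqI[OF openH z])
      fix i w assume w: "w \<in> H"
      have P: "((\<lambda>w. log_partial_deriv m i (w + of_real x) + poly ((pderiv ^^ i) (partial_poly m)) (w + of_real x))
         has_field_derivative (log_partial_deriv m (Suc i) (w + of_real x) + poly ((pderiv ^^ Suc i) (partial_poly m)) (w + of_real x))) (at w)"
        if "0 \<le> x" for x
        using DERIV_log_partial_deriv[of "w + of_real x" m i] shift[OF w that]
          poly_DERIV[of "(pderiv ^^ i) (partial_poly m)" "w + of_real x"]
        by (intro DERIV_add) (simp_all add: DERIV_shift)
      show "(E m i has_field_derivative E m (Suc i) w) (at w)"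
        unfolding E_def by (intro DERIV_sum DERIV_diff P nonneg)
    qed
    also have "(\<Sum>k=1..n. poly ((pderiv ^^ q) (partial_poly m)) (z + of_real (a k))) =
        (\<Sum>k=1..n. poly ((pderiv ^^ q) (partial_poly m)) (z + of_real (b k)))"
    proof (rule sum_poly_shift_eq)
      show "degree ((pderiv ^^ q) (partial_poly m)) \<le> l"
        using degree_funpow_pderiv_le[of q "partial_poly m"] degree_partial_poly[of m] degree by linarith
      show "(\<Sum>k=1..n. complex_of_real (a k) ^ j) = (\<Sum>k=1..n. complex_of_real (b k) ^ j)" if "j \<le> l" for j
        using arg_cong[OF power_sums[OF that], of complex_of_real] by simp
    qed
    then have "E m q z = (\<Sum>k=1..n. log_partial_deriv m q (z + of_real (a k)) - log_partial_deriv m q (z + of_real (b k)))"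
      by (simp add: E_def sum.distrib sum_subtractf)
    finally show ?thesis .
  qed
  \<comment> \<open>The partial sums of the logarithm converge uniformly on bounded sets only.\<close>
  define A where "A = H \<inter> ball 0 (norm z + 1)"
  obtain C where C: "\<And>z. z \<notin> \<real>\<^sub>\<le>\<^sub>0 \<Longrightarrow> log_branch f z = log_f z + C" using log_branch_eq by blast
  have lim: "uniform_limit A G (log_W f n a b) sequentially"
  proof -
    have one: "uniform_limit A (\<lambda>m w. log_partial m (w + of_real x)) (\<lambda>w. log_f (w + of_real x)) sequentially"
      if "0 \<le> x" for x
    proof (rule uniform_limit_compose'[OF uniform_limit_log_partial[of "norm z + 1 + x"]])
      show "(\<lambda>w. w + of_real x) \<in> A \<rightarrow> cball 0 (norm z + 1 + x)"
        using that by (auto simp: A_def intro!: norm_triangle_le)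
    qed
    have "uniform_limit A G (\<lambda>w. \<Sum>k=1..n. log_f (w + of_real (a k)) - log_f (w + of_real (b k))) sequentially"
      unfolding G_def by (intro uniform_limit_sum uniform_limit_intros one nonneg)
    moreover have "(\<Sum>k=1..n. log_f (w + of_real (a k)) - log_f (w + of_real (b k))) = log_W f n a b w" if "w \<in> A" for w
      unfolding log_W_def using that nonneg shift C by (intro sum.cong) (auto simp: A_def)
    ultimately show ?thesis by (simp cong: uniform_limit_cong')
  qed
  have "(\<lambda>m. (deriv ^^ q) (G m) z) \<longlonglongrightarrow> (deriv ^^ q) (log_W f n a b) z"
  proof (rule higher_deriv_complex_uniform_limit[OF lim])
    have hol: "(\<lambda>w. log_partial m (w + of_real x)) holomorphic_on A" if "0 \<le> x" for m x
      using shift that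
      by (intro holomorphic_on_compose_gen[OF _ log_partial_holomorphic, unfolded o_def] holomorphic_intros)
        (auto simp: A_def)
    show "\<forall>\<^sub>F m in sequentially. G m holomorphic_on A"
      unfolding G_def by (intro always_eventually allI holomorphic_on_sum holomorphic_on_diff hol nonneg)
  qed (use z openH in \<open>auto simp: A_def H_def\<close>)
  then show ?thesis using derivG z by (simp add: H_def)
qed

text \<open>The partial sums of \<open>h\<close>, in the order of the factors; the zero at the origin enters as a block.\<close>
definition zero_exp_partial :: "nat \<Rightarrow> real \<Rightarrow> real" where
  "zero_exp_partial m s = real r + (\<Sum>k<m. if k \<in> I then exp (- \<kappa> k * s) else 0)"

text \<open>
  The logarithm belonging to the zero \<open>- \<kappa> k\<close> is evaluated at \<open>w = z + \<kappa> k\<close>, which puts the factor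
  \<open>exp (- \<kappa> k * s)\<close> into the integrand.
\<close>
lemma laplace_log_partial_deriv:
  fixes a b :: "nat \<Rightarrow> real"
  assumes z: "0 < Re z"
    and nonneg: "\<And>k. k \<in> {1..n} \<Longrightarrow> 0 \<le> a k" "\<And>k. k \<in> {1..n} \<Longrightarrow> 0 \<le> b k"
  shows "has_bochner_integral lborel
     (\<lambda>s. indicator {0<..} s *\<^sub>R (exp (- of_real s * z) * of_real (s ^ Suc q * zero_exp_partial m s * g_fun n a b s)))
     ((-1) ^ Suc q * (\<Sum>k=1..n. log_partial_deriv m q (z + of_real (a k)) - log_partial_deriv m q (z + of_real (b k))))"
proof -
  define J where "J = (\<lambda>(w::complex) k (s::real). indicator {0<..} s *\<^sub>R
     (of_real (s ^ q * ((exp (- s * a k) - exp (- s * b k)) / s)) * exp (- of_real s * w)))"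
  define V where "V = (\<lambda>w k. (-1) ^ Suc q * (Ln_deriv q (w + of_real (a k)) - Ln_deriv q (w + of_real (b k))))"
  have J: "has_bochner_integral lborel (J w k) (V w k)" if "0 < Re w" "k \<in> {1..n}" for w k
    unfolding J_def V_def using that nonneg by (intro laplace_Ln_deriv_diff)
  have "has_bochner_integral lborel
     (\<lambda>s. \<Sum>k=1..n. of_nat r * J z k s + (\<Sum>i<m. if i \<in> I then J (z + of_real (\<kappa> i)) k s else 0))
     (\<Sum>k=1..n. of_nat r * V z k + (\<Sum>i<m. if i \<in> I then V (z + of_real (\<kappa> i)) k else 0))"
  proof (intro has_bochner_integral_sum has_bochner_integral_add has_bochner_integral_mult_right J z)
    fix k i assume k: "k \<in> {1..n}"
    show "has_bochner_integral lborel (\<lambda>s. if i \<in> I then J (z + of_real (\<kappa> i)) k s else 0)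
       (if i \<in> I then V (z + of_real (\<kappa> i)) k else 0)"
      using J[of "z + of_real (\<kappa> i)" k] k z \<kappa>_pos[of i]
      by (cases "i \<in> I") (auto simp: has_bochner_integral_zero)
  qed
  also have "(\<Sum>k=1..n. of_nat r * V z k + (\<Sum>i<m. if i \<in> I then V (z + of_real (\<kappa> i)) k else 0)) =
     (-1) ^ Suc q * (\<Sum>k=1..n. log_partial_deriv m q (z + of_real (a k)) - log_partial_deriv m q (z + of_real (b k)))"
    unfolding sum_distrib_left[of "(-1) ^ Suc q"]
  proof (rule sum.cong[OF refl])
    fix k
    have swap: "z + of_real (\<kappa> i) + of_real x = z + of_real x + complex_of_real (\<kappa> i)" for i x
      by simp
    have "(-1) ^ Suc q * ((\<Sum>i<m. if i \<in> I then Ln_deriv q (z + of_real (a k) + of_real (\<kappa> i)) else 0) -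
           (\<Sum>i<m. if i \<in> I then Ln_deriv q (z + of_real (b k) + of_real (\<kappa> i)) else 0)) =
        (\<Sum>i<m. if i \<in> I then V (z + of_real (\<kappa> i)) k else 0)"
      unfolding sum_subtractf[symmetric] sum_distrib_left
      by (intro sum.cong refl) (simp only: V_def swap split: if_split, simp)
    then show "of_nat r * V z k + (\<Sum>i<m. if i \<in> I then V (z + of_real (\<kappa> i)) k else 0) =
      (-1) ^ Suc q * (log_partial_deriv m q (z + of_real (a k)) - log_partial_deriv m q (z + of_real (b k)))"
      unfolding log_partial_deriv_def V_def by (simp only: algebra_simps)
  qed
  also have "(\<lambda>s. \<Sum>k=1..n. of_nat r * J z k s + (\<Sum>i<m. if i \<in> I then J (z + of_real (\<kappa> i)) k s else 0)) =
     (\<lambda>s. indicator {0<..} s *\<^sub>R (exp (- of_real s * z) * of_real (s ^ Suc q * zero_exp_partial m s * g_fun n a b s)))"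
  proof
    fix s :: real
    have shift: "J (z + of_real (\<kappa> i)) k s = of_real (exp (- \<kappa> i * s)) * J z k s" for i k
    proof -
      have "exp (- of_real s * (z + of_real (\<kappa> i))) = exp (- of_real s * z) * complex_of_real (exp (- \<kappa> i * s))"
        by (simp add: distrib_left exp_diff exp_minus divide_inverse exp_of_real mult.commute flip: of_real_mult)
      then show ?thesis by (simp add: J_def)
    qed
    have "(\<Sum>i<m. if i \<in> I then J (z + of_real (\<kappa> i)) k s else 0) =
        (\<Sum>i<m. of_real (if i \<in> I then exp (- \<kappa> i * s) else 0) * J z k s)" for k
      by (intro sum.cong refl) (simp add: shift)
    then have "of_nat r * J z k s + (\<Sum>i<m. if i \<in> I then J (z + of_real (\<kappa> i)) k s else 0) =
       of_real (zero_exp_partial m s) * J z k s" for k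
      by (simp add: zero_exp_partial_def distrib_right flip: sum_distrib_right)
    then have "(\<Sum>k=1..n. of_nat r * J z k s + (\<Sum>i<m. if i \<in> I then J (z + of_real (\<kappa> i)) k s else 0)) =
       of_real (zero_exp_partial m s) * (\<Sum>k=1..n. J z k s)"
      by (simp flip: sum_distrib_left)
    also have "(\<Sum>k=1..n. J z k s) = indicator {0<..} s *\<^sub>R (exp (- of_real s * z) * of_real (s ^ Suc q * g_fun n a b s))"
    proof (cases "0 < s")
      case True
      have "(\<Sum>k=1..n. J z k s) = of_real (\<Sum>k=1..n. s ^ q * ((exp (- s * a k) - exp (- s * b k)) / s)) * exp (- of_real s * z)"
        unfolding of_real_sum sum_distrib_right using True by (intro sum.cong refl) (simp add: J_def)
      also have "(\<Sum>k=1..n. s ^ q * ((exp (- s * a k) - exp (- s * b k)) / s)) = s ^ Suc q * g_fun n a b s"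
        using True by (simp add: g_fun_def sum_distrib_left[symmetric] sum_divide_distrib[symmetric] power2_eq_square)
      finally show ?thesis using True by simp
    qed (simp add: J_def)
    finally show "(\<Sum>k=1..n. of_nat r * J z k s + (\<Sum>i<m. if i \<in> I then J (z + of_real (\<kappa> i)) k s else 0)) =
       indicator {0<..} s *\<^sub>R (exp (- of_real s * z) * of_real (s ^ Suc q * zero_exp_partial m s * g_fun n a b s))"
      by (simp add: mult_ac)
  qed
  finally show ?thesis .
qed

lemma zero_exp_partial_mono: "m \<le> m' \<Longrightarrow> zero_exp_partial m s \<le> zero_exp_partial m' s"
  unfolding zero_exp_partial_def by (intro add_left_mono sum_mono2) auto

lemma zero_exp_partial_nonneg: "0 \<le> zero_exp_partial m s"
  unfolding zero_exp_partial_def by (intro add_nonneg_nonneg sum_nonneg) auto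

text \<open>
  Where \<open>h\<close> does not vanish, \<open>g\<close> is non-negative; so at the real point \<open>Re z\<close> the partial integrands are
  non-negative and increase with \<open>m\<close>. Their integrals converge there by
  \<open>tendsto_higher_deriv_log_W\<close>, and monotone convergence makes the limit integrable. At \<open>z\<close> itself this
  limit is the dominating function.
\<close>
lemma higher_deriv_log_W_laplace:
  fixes a b :: "nat \<Rightarrow> real" and h :: "real \<Rightarrow> real"
  assumes z: "0 < Re z"
    and nonneg: "\<And>k. k \<in> {1..n} \<Longrightarrow> 0 \<le> a k" "\<And>k. k \<in> {1..n} \<Longrightarrow> 0 \<le> b k"
    and power_sums: "\<And>j. j \<le> l \<Longrightarrow> (\<Sum>k=1..n. a k ^ j) = (\<Sum>k=1..n. b k ^ j)"
    and degree: "max d (degree Q) \<le> l + q"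
    and h: "\<And>s. 0 < s \<Longrightarrow> (\<lambda>m. zero_exp_partial m s) \<longlonglongrightarrow> h s"
    and hg: "\<And>s. 0 < s \<Longrightarrow> 0 \<le> h s * g_fun n a b s"
  shows "has_bochner_integral lborel
     (\<lambda>s. indicator {0<..} s *\<^sub>R (exp (- of_real s * z) * of_real (s ^ Suc q * h s * g_fun n a b s)))
     ((-1) ^ Suc q * (deriv ^^ q) (log_W f n a b) z)"
proof -
  define g where "g = g_fun n a b"
  define H where "H = zero_exp_partial"
  have H_le: "H m s \<le> h s" if "0 < s" for m s
    by (rule incseq_le[OF _ h[OF that, folded H_def]]) (simp add: incseq_def H_def zero_exp_partial_mono)
  have Hg: "0 \<le> H m s * g s" "H m s * g s \<le> H m' s * g s" "H m s * g s \<le> h s * g s"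
    if "0 < s" "m \<le> m'" for m m' s
  proof -
    have H0: "0 \<le> H m s" "H m s \<le> H m' s" "H m' s \<le> h s" "H m s \<le> h s"
      using zero_exp_partial_nonneg zero_exp_partial_mono[OF that(2)] H_le[OF that(1)] by (auto simp: H_def)
    have "0 \<le> H m s * g s \<and> H m s * g s \<le> H m' s * g s \<and> H m s * g s \<le> h s * g s"
    proof (cases "h s = 0")
      case True
      then have "H m s = 0" "H m' s = 0" using H0 by linarith+
      then show ?thesis using True by simp
    next
      case False
      then have "0 \<le> g s" using hg[OF that(1)] H0 by (auto simp: g_def zero_le_mult_iff)
      then show ?thesis using H0 by (simp add: mult_right_mono)
    qed
    then show "0 \<le> H m s * g s" "H m s * g s \<le> H m' s * g s" "H m s * g s \<le> h s * g s"
      by blast+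
  qed
  define K where "K = (\<lambda>(z::complex) m (s::real). indicator {0<..} s *\<^sub>R (exp (- of_real s * z) * of_real (s ^ Suc q * H m s * g s)))"
  define kr where "kr = (\<lambda>m s. indicator {0<..} s * (exp (- s * Re z) * (s ^ Suc q * (H m s * g s))))"
  define u where "u = (\<lambda>s. indicator {0<..} s * (exp (- s * Re z) * (s ^ Suc q * (h s * g s))))"
  have K: "has_bochner_integral lborel (K w m)
     ((-1) ^ Suc q * (\<Sum>k=1..n. log_partial_deriv m q (w + of_real (a k)) - log_partial_deriv m q (w + of_real (b k))))"
    if "0 < Re w" for w m
    unfolding K_def H_def g_def by (rule laplace_log_partial_deriv[OF that nonneg])
  have limK: "(\<lambda>m. integral\<^sup>L lborel (K w m)) \<longlonglongrightarrow> (-1) ^ Suc q * (deriv ^^ q) (log_W f n a b) w"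
    if "0 < Re w" for w
    using tendsto_mult_left[OF tendsto_higher_deriv_log_W[OF that nonneg power_sums degree], of "(-1) ^ Suc q"] K[OF that]
    by (simp add: has_bochner_integral_iff)
  have kr: "has_bochner_integral lborel (kr m) (Re (integral\<^sup>L lborel (K (of_real (Re z)) m)))" for m
  proof -
    have "Re (K (of_real (Re z)) m s) = kr m s" for s
    proof -
      have "exp (- of_real s * of_real (Re z)) = complex_of_real (exp (- s * Re z))"
        by (simp flip: exp_of_real)
      then have "K (of_real (Re z)) m s = of_real (kr m s)"
        by (simp add: K_def kr_def scaleR_conv_of_real mult.assoc)
      then show ?thesis by simp
    qed
    then show ?thesis
      using has_bochner_integral_Re[OF K[of "of_real (Re z)" m]] K[of "of_real (Re z)" m] z
      by (simp add: has_bochner_integral_iff)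
  qed
  have lim_ind: "(\<lambda>m. indicator {0<..} s * (c s * (H m s * g s))) \<longlonglongrightarrow> indicator {0<..} s * (c s * (h s * g s))"
    for c :: "real \<Rightarrow> real" and s
  proof (cases "0 < s")
    case True
    then show ?thesis using h[OF True] by (auto simp: H_def intro!: tendsto_intros)
  qed simp
  have u_lim: "(\<lambda>m. kr m s) \<longlonglongrightarrow> u s" for s
    using lim_ind[of s "\<lambda>s. exp (- s * Re z) * s ^ Suc q"] by (simp add: kr_def u_def mult_ac)
  have u_meas: "u \<in> borel_measurable lborel"
  proof (rule borel_measurable_LIMSEQ_real[OF u_lim])
    show "kr m \<in> borel_measurable lborel" for m using kr[of m] by (auto simp: has_bochner_integral_iff)
  qed
  have int_u: "integrable lborel u"
  proof (rule integrable_monotone_convergence)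
    show "integrable lborel (kr m)" for m using kr[of m] by (simp add: has_bochner_integral_iff)
    have "kr m s \<le> kr m' s" if "m \<le> m'" for m m' s
    proof (cases "0 < s")
      case True
      then show ?thesis using Hg(2)[OF True that] by (simp add: kr_def mult_left_mono)
    qed (simp add: kr_def)
    then show "AE s in lborel. mono (\<lambda>m. kr m s)" by (intro AE_I2 monoI)
    show "(\<lambda>m. integral\<^sup>L lborel (kr m)) \<longlonglongrightarrow> Re ((-1) ^ Suc q * (deriv ^^ q) (log_W f n a b) (of_real (Re z)))"
      using tendsto_Re[OF limK[of "of_real (Re z)"]] kr z by (simp add: has_bochner_integral_iff)
  qed (use u_lim u_meas in auto)
  define U where "U = (\<lambda>s. indicator {0<..} s *\<^sub>R (exp (- of_real s * z) * of_real (s ^ Suc q * h s * g s)))"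
  have U_lim: "(\<lambda>m. K z m s) \<longlonglongrightarrow> U s" for s
  proof (cases "0 < s")
    case True
    then show ?thesis using h[OF True] by (auto simp: K_def U_def H_def intro!: tendsto_intros)
  qed (simp add: K_def U_def)
  have K_le: "norm (K z m s) \<le> u s" for m s
  proof (cases "0 < s")
    case True
    then have "norm (K z m s) = exp (- s * Re z) * s ^ Suc q * (H m s * g s)"
      using Hg(1)[OF True order.refl[of m]] by (simp add: K_def norm_mult norm_power abs_mult[symmetric])
    also have "\<dots> \<le> exp (- s * Re z) * s ^ Suc q * (h s * g s)"
      using True Hg(3)[OF True order.refl[of m]] by (intro mult_left_mono) auto
    finally show ?thesis using True by (simp add: u_def mult_ac)
  qed (simp add: K_def u_def)
  have K_meas: "K z m \<in> borel_measurable lborel" for m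
    using K[OF z, of m] by (auto simp: has_bochner_integral_iff)
  have U_meas: "U \<in> borel_measurable lborel"
    by (rule borel_measurable_LIMSEQ_metric[OF K_meas U_lim])
  have "integrable lborel U" "(\<lambda>m. integral\<^sup>L lborel (K z m)) \<longlonglongrightarrow> integral\<^sup>L lborel U"
    using U_lim K_le K_meas U_meas int_u
    by (auto intro!: integrable_dominated_convergence[where w = u and s = "K z"]
        integral_dominated_convergence[where w = u])
  with LIMSEQ_unique[OF this(2) limK[OF z]] show ?thesis
    by (simp add: has_bochner_integral_iff U_def g_def)
qed

end

section \<open>Matching the sequence of zeros with the factors\<close>

lemma equal_fibres_bij:
  assumes fin: "\<And>v. finite {x \<in> A. f x = v}" "\<And>v. finite {y \<in> B. g y = v}"
    and card: "\<And>v. card {x \<in> A. f x = v} = card {y \<in> B. g y = v}"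
  obtains \<pi> where "bij_betw \<pi> A B" "\<And>x. x \<in> A \<Longrightarrow> g (\<pi> x) = f x"
proof -
  have "\<forall>v. \<exists>\<sigma>. bij_betw \<sigma> {x \<in> A. f x = v} {y \<in> B. g y = v}"
    using fin card by (metis finite_same_card_bij)
  then obtain \<sigma> where \<sigma>: "\<And>v. bij_betw (\<sigma> v) {x \<in> A. f x = v} {y \<in> B. g y = v}" by metis
  define \<pi> where "\<pi> = (\<lambda>x. \<sigma> (f x) x)"
  have mem: "\<pi> x \<in> B \<and> g (\<pi> x) = f x" if "x \<in> A" for x
    using bij_betw_apply[OF \<sigma>[of "f x"], of x] that by (auto simp: \<pi>_def)
  have "inj_on \<pi> A"
  proof (rule inj_onI)
    fix x y assume xy: "x \<in> A" "y \<in> A" "\<pi> x = \<pi> y"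
    then have "f x = f y" using mem by metis
    then show "x = y" using xy bij_betw_imp_inj_on[OF \<sigma>[of "f x"]]
      by (auto simp: \<pi>_def inj_on_def)
  qed
  moreover have "\<pi> ` A = B"
  proof (intro equalityI subsetI)
    fix y assume y: "y \<in> B"
    then obtain x where "x \<in> A" "f x = g y" "\<sigma> (g y) x = y"
      using bij_betw_imp_surj_on[OF \<sigma>[of "g y"]] by (force simp: set_eq_iff image_iff)
    then show "y \<in> \<pi> ` A" by (auto simp: \<pi>_def image_iff intro!: bexI[of _ x])
  qed (use mem in auto)
  ultimately show ?thesis using that mem by (auto simp: bij_betw_def)
qed

lemma sums_if_infsum:
  fixes f :: "nat \<Rightarrow> real"
  assumes "f summable_on A"
  shows "(\<lambda>m. if m \<in> A then f m else 0) sums infsum f A"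
proof -
  have "(f has_sum infsum f A) A" using assms by simp
  also have "?this \<longleftrightarrow> ((\<lambda>m. if m \<in> A then f m else 0) has_sum infsum f A) UNIV"
    by (intro has_sum_cong_neutral) auto
  finally show ?thesis by (rule has_sum_imp_sums)
qed

context nonpositive_hadamard_product
begin

text \<open>
  Both families count each point with the order of \<open>f\<close> there, so their fibres have equal finite
  cardinality. The summand \<open>{..<r}\<close> indexes the copies of the zero at the origin.
\<close>
lemma zero_sequence_bij:
  assumes "zero_sequence f N lam"
  obtains \<pi> where "bij_betw \<pi> (idx N) ({..<r} <+> I)"
    "\<And>m. m \<in> idx N \<Longrightarrow> lam m = case_sum (\<lambda>_. 0) \<kappa> (\<pi> m)"
proof -
  define \<zeta> :: "nat + nat \<Rightarrow> complex" where "\<zeta> = case_sum (\<lambda>_. 0) c"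
  define B where "B = {..<r} <+> I"
  \<comment> \<open>Since \<open>c k \<noteq> 0\<close> on \<open>I\<close>, the two summands never contribute to the same fibre.\<close>
  have fibre: "{y \<in> B. \<zeta> y = v} = {i \<in> {..<r}. v = 0} <+> {k \<in> I. c k = v}" for v
    by (auto simp: B_def \<zeta>_def)
  have fin: "finite {y \<in> B. \<zeta> y = v}" for v
    unfolding fibre by (intro finite_Plus finite_fibre) simp
  have card: "card {y \<in> B. \<zeta> y = v} = (if v = 0 then r else 0) + card {k \<in> I. c k = v}" for v
    unfolding fibre using finite_fibre by (subst card_Plus) auto
  have fibres: "finite {m \<in> idx N. - complex_of_real (lam m) = v}"
    "int (card {m \<in> idx N. - complex_of_real (lam m) = v}) = zorder f v" for v
    using assms by (simp_all add: zero_sequence_def eq_commute)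
  have fibres': "card {m \<in> idx N. - complex_of_real (lam m) = v} = card {y \<in> B. \<zeta> y = v}" for v
    using fibres(2)[of v] unfolding zorder_eq_card card by (simp only: of_nat_eq_iff)
  obtain \<pi> where \<pi>: "bij_betw \<pi> (idx N) B" "\<And>m. m \<in> idx N \<Longrightarrow> \<zeta> (\<pi> m) = - complex_of_real (lam m)"
    using equal_fibres_bij[OF fibres(1) fin fibres'] by blast
  have "lam m = case_sum (\<lambda>_. 0) \<kappa> (\<pi> m)" if m: "m \<in> idx N" for m
    using \<pi>(2)[OF m] bij_betw_apply[OF \<pi>(1) m]
    by (auto simp: \<zeta>_def B_def c_eq)
  with \<pi>(1) show ?thesis by (intro that) (simp_all add: B_def)
qed

lemma zero_sequence_nonneg:
  assumes "zero_sequence f N lam" "m \<in> idx N"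
  shows "0 \<le> lam m"
proof -
  obtain \<pi> where \<pi>: "bij_betw \<pi> (idx N) ({..<r} <+> I)"
    "\<And>m. m \<in> idx N \<Longrightarrow> lam m = case_sum (\<lambda>_. 0) \<kappa> (\<pi> m)"
    using zero_sequence_bij[OF assms(1)] by blast
  from bij_betw_apply[OF \<pi>(1) assms(2)] have "0 \<le> case_sum (\<lambda>_. 0) \<kappa> (\<pi> m)"
    using \<kappa>_pos by (auto intro: less_imp_le)
  with \<pi>(2)[OF assms(2)] show ?thesis by simp
qed

text \<open>Exponential decay beats the power \<open>d + 1\<close> for which the inverse moduli of the zeros are summable.\<close>
lemma summable_exp_\<kappa>:
  assumes s: "0 < s"
  shows "(\<lambda>k. exp (- \<kappa> k * s)) summable_on I"
proof -
  have power_le_exp: "x ^ m \<le> fact m * exp x" if "0 \<le> x" for x :: real and m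
  proof -
    have "(\<Sum>i\<in>{m}. x ^ i /\<^sub>R fact i) \<le> (\<Sum>i. x ^ i /\<^sub>R fact i)"
      using that by (intro sum_le_suminf summable_exp_generic) auto
    then show ?thesis by (simp add: exp_def field_simps)
  qed
  have "summable (\<lambda>k. if k \<in> I then exp (- \<kappa> k * s) else 0)"
  proof (rule summable_comparison_test')
    show "summable (\<lambda>k. (fact (Suc d) / s ^ Suc d) * (if k \<in> I then 1 / norm (c k) ^ Suc d else 0))"
      by (intro summable_mult summable_c)
    show "norm (if k \<in> I then exp (- \<kappa> k * s) else 0)
        \<le> (fact (Suc d) / s ^ Suc d) * (if k \<in> I then 1 / norm (c k) ^ Suc d else 0)" for k
    proof (cases "k \<in> I")
      case True
      then have \<kappa>: "0 < \<kappa> k" "norm (c k) = \<kappa> k" using \<kappa>_pos[of k] by (simp_all add: c_eq)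
      have "(\<kappa> k * s) ^ Suc d \<le> fact (Suc d) * exp (\<kappa> k * s)"
        using \<kappa> s by (intro power_le_exp) simp
      then have "exp (- (\<kappa> k * s)) \<le> fact (Suc d) / (\<kappa> k * s) ^ Suc d"
        using \<kappa> s by (simp add: exp_minus field_simps)
      then show ?thesis using True \<kappa> by (simp add: power_mult_distrib mult_ac)
    qed simp
  qed
  then have "(\<lambda>k. if k \<in> I then exp (- \<kappa> k * s) else 0) summable_on UNIV"
    by (intro norm_summable_imp_summable_on) (simp add: if_distrib cong: if_cong)
  also have "?this \<longleftrightarrow> ?thesis" by (intro summable_on_cong_neutral) auto
  finally show ?thesis .
qed

lemma zero_sequence_exp_sum:
  assumes zs: "zero_sequence f N lam" and s: "0 < s"
  shows "(\<lambda>m. exp (- lam m * s)) summable_on idx N"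
    and "(\<lambda>m. zero_exp_partial m s) \<longlonglongrightarrow> h_fun N lam s"
proof -
  obtain \<pi> where \<pi>: "bij_betw \<pi> (idx N) ({..<r} <+> I)"
    "\<And>m. m \<in> idx N \<Longrightarrow> lam m = case_sum (\<lambda>_. 0) \<kappa> (\<pi> m)"
    using zero_sequence_bij[OF zs] by blast
  define E where "E = (\<lambda>y :: nat + nat. exp (- (case_sum (\<lambda>_. 0) \<kappa> y) * s))"
  define x where "x = (\<Sum>\<^sub>\<infinity>k\<in>I. exp (- \<kappa> k * s))"
  have "(E has_sum real r) (Inl ` {..<r})"
  proof -
    have "((\<lambda>i. E (Inl i)) has_sum (\<Sum>i<r. E (Inl i))) {..<r}" by (intro has_sum_finite) simp
    then show ?thesis by (subst has_sum_reindex) (simp_all add: E_def o_def)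
  qed
  moreover have "(E has_sum x) (Inr ` I)"
    using summable_exp_\<kappa>[OF s] by (subst has_sum_reindex) (simp_all add: E_def o_def x_def)
  ultimately have "(E has_sum (real r + x)) ({..<r} <+> I)"
    unfolding Plus_def by (intro has_sum_Un_disjoint) auto
  then have "((\<lambda>m. E (\<pi> m)) has_sum (real r + x)) (idx N)"
    using has_sum_reindex_bij_betw[OF \<pi>(1), of E] by simp
  also have "?this \<longleftrightarrow> ((\<lambda>m. exp (- lam m * s)) has_sum (real r + x)) (idx N)"
    by (intro has_sum_cong) (simp add: E_def \<pi>(2))
  finally have sum: "((\<lambda>m. exp (- lam m * s)) has_sum (real r + x)) (idx N)" .
  then show "(\<lambda>m. exp (- lam m * s)) summable_on idx N" by (rule has_sum_imp_summable)
  have "h_fun N lam s = real r + x" unfolding h_fun_def by (rule infsumI[OF sum])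
  moreover have "(\<lambda>k. if k \<in> I then exp (- \<kappa> k * s) else 0) sums x"
    unfolding x_def by (rule sums_if_infsum[OF summable_exp_\<kappa>[OF s]])
  ultimately show "(\<lambda>m. zero_exp_partial m s) \<longlonglongrightarrow> h_fun N lam s"
    unfolding zero_exp_partial_def sums_def by (auto intro: tendsto_intros)
qed

end

lemma class_E_hadamard:
  assumes "f \<in> class_E p"
  obtains r Q d I c where "nonpositive_hadamard_product f r Q d I c" "p = max d (degree Q)"
proof -
  have f: "f holomorphic_on UNIV" "has_genus f p" "\<And>x::real. f (of_real x) \<in> \<real>"
    "\<And>z. f z = 0 \<Longrightarrow> Im z = 0 \<and> Re z \<le> 0" "\<And>x::real. x > 0 \<Longrightarrow> Re (f (of_real x)) > 0"
    using assms by (auto simp: class_E_def)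
  from f(2) obtain r Q d N c where g: "\<forall>k\<in>idx N. c k \<noteq> 0"
    "(\<lambda>k. 1 / norm (c k) ^ (d + 1)) summable_on idx N"
    "\<forall>z. \<exists>P. (\<lambda>k. if k \<in> idx N then weierstrass_factor d (z / c k) else 1) has_prod P \<and>
                 f z = z ^ r * exp (poly Q z) * P" "p = max d (degree Q)"
    unfolding has_genus_def by blast
  have "nonpositive_hadamard_product f r Q d (idx N) c"
  proof
    show "summable (\<lambda>k. if k \<in> idx N then 1 / norm (c k) ^ Suc d else 0)"
      using sums_summable[OF sums_if_infsum[OF g(2)]] by (simp only: Suc_eq_plus1)
  qed (use f g in auto)
  with g(4) show ?thesis by (intro that)
qed

section \<open>Positivity of \<open>\<phi>\<close> and its Laplace transform\<close>

lemma idx_iff: "k \<in> idx M \<longleftrightarrow> 1 \<le> k \<and> enat k \<le> M"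
  by (simp add: idx_def)

lemma rho_fun_eq_sum_max: "rho_fun n a b t = (\<Sum>k=1..n. max 0 (t - a k)) - (\<Sum>k=1..n. max 0 (t - b k))"
  unfolding rho_fun_def
  by (intro arg_cong2[where f = "(-)"] sum.cong refl) (auto simp: indicator_def max_def)

lemma infsum_eq_sum_superset:
  assumes "finite X" "X \<subseteq> A" "\<And>x. x \<in> A - X \<Longrightarrow> f x = 0"
  shows "infsum f A = (\<Sum>x\<in>X. f x)"
proof -
  have "infsum f A = infsum f X" using assms by (intro infsum_cong_neutral) auto
  then show ?thesis using assms by simp
qed

text \<open>
  The classical passage from weak majorization to the convex functions \<open>x \<mapsto> (t - x)\<^sub>+\<close>. With \<open>K\<close> the
  number of \<open>\<mu>b k \<le> t\<close>, the sum for \<open>\<mu>b\<close> is \<open>K t\<close> minus the \<open>K\<close>-th partial sum, which is at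
  most the same expression for \<open>\<mu>a\<close>; the latter only increases when its negative terms are
  dropped and further positive ones are added.
\<close>
lemma sum_hinge_le_if_partial_sums_le:
  fixes \<mu>a \<mu>b :: "nat \<Rightarrow> real"
  assumes mono: "mono_on (idx M) \<mu>b"
    and fin: "finite {k \<in> idx M. \<mu>a k \<le> t}" "finite {k \<in> idx M. \<mu>b k \<le> t}"
    and le: "\<And>m. m \<in> idx M \<Longrightarrow> (\<Sum>k=1..m. \<mu>a k) \<le> (\<Sum>k=1..m. \<mu>b k)"
  shows "(\<Sum>\<^sub>\<infinity>k\<in>idx M. max 0 (t - \<mu>b k)) \<le> (\<Sum>\<^sub>\<infinity>k\<in>idx M. max 0 (t - \<mu>a k))"
proof -
  define S where "S = {k \<in> idx M. \<mu>b k \<le> t}"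
  \<comment> \<open>As \<open>\<mu>b\<close> is non-decreasing, \<open>S\<close> is an initial segment.\<close>
  obtain K where K: "S = {1..K}" "K = 0 \<or> K \<in> idx M"
  proof (cases "S = {}")
    case False
    define K where "K = Max S"
    have "finite S" using fin by (simp add: S_def)
    then have KS: "K \<in> S" "\<And>k. k \<in> S \<Longrightarrow> k \<le> K"
      using False by (simp_all add: K_def)
    have low: "k \<in> S" if "1 \<le> k" "k \<le> K" for k
    proof -
      have "enat k \<le> enat K" using that by simp
      with KS(1) that have "k \<in> idx M" unfolding S_def idx_iff
        using order.trans[OF \<open>enat k \<le> enat K\<close>, of M] by auto
      then show ?thesis using mono_onD[OF mono, of k K] KS(1) that by (auto simp: S_def)
    qed
    have "S = {1..K}"
    proof (rule set_eqI)
      fix k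
      show "k \<in> S \<longleftrightarrow> k \<in> {1..K}"
        using low[of k] KS(2)[of k] by (auto simp: S_def idx_iff)
    qed
    moreover have "K \<in> idx M" using KS(1) by (simp add: S_def)
    ultimately show ?thesis by (intro that disjI2)
  qed (use that[of 0] in simp)
  have sub: "{1..K} \<subseteq> idx M" using K(1) by (auto simp: S_def)
  have "(\<Sum>\<^sub>\<infinity>k\<in>idx M. max 0 (t - \<mu>b k)) = (\<Sum>k\<in>S. max 0 (t - \<mu>b k))"
    using fin(2) by (intro infsum_eq_sum_superset) (auto simp: S_def)
  also have "\<dots> = (\<Sum>k\<in>S. t - \<mu>b k)" by (intro sum.cong) (auto simp: S_def)
  also have "\<dots> \<le> (\<Sum>k\<in>S. t - \<mu>a k)"
    using K le[of K] by (auto simp: sum_subtractf)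
  also have "\<dots> \<le> (\<Sum>k\<in>S. max 0 (t - \<mu>a k))" by (intro sum_mono) simp
  also have "\<dots> \<le> (\<Sum>k\<in>S \<union> {k \<in> idx M. \<mu>a k \<le> t}. max 0 (t - \<mu>a k))"
    using fin by (intro sum_mono2) (auto simp: S_def)
  also have "\<dots> = (\<Sum>\<^sub>\<infinity>k\<in>idx M. max 0 (t - \<mu>a k))"
    using fin by (intro infsum_eq_sum_superset[symmetric]) (auto simp: S_def)
  finally show ?thesis .
qed

lemma rearrangement_sum_hinge:
  assumes "nondecr_rearrangement J F M \<mu>"
  shows "(\<Sum>\<^sub>\<infinity>k\<in>idx M. max 0 (t - \<mu> k)) = (\<Sum>\<^sub>\<infinity>x\<in>J. max 0 (t - F x))"
    and "finite {x \<in> J. F x \<le> t} \<Longrightarrow> finite {k \<in> idx M. \<mu> k \<le> t}"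
proof -
  obtain \<pi> where \<pi>: "bij_betw \<pi> (idx M) J" "\<And>k. k \<in> idx M \<Longrightarrow> \<mu> k = F (\<pi> k)"
    using assms by (auto simp: nondecr_rearrangement_def)
  have "(\<Sum>\<^sub>\<infinity>k\<in>idx M. max 0 (t - \<mu> k)) = (\<Sum>\<^sub>\<infinity>k\<in>idx M. max 0 (t - F (\<pi> k)))"
    by (intro infsum_cong) (simp add: \<pi>)
  also have "\<dots> = (\<Sum>\<^sub>\<infinity>x\<in>J. max 0 (t - F x))"
    by (rule infsum_reindex_bij_betw[OF \<pi>(1)])
  finally show "(\<Sum>\<^sub>\<infinity>k\<in>idx M. max 0 (t - \<mu> k)) = (\<Sum>\<^sub>\<infinity>x\<in>J. max 0 (t - F x))" .
  assume fin: "finite {x \<in> J. F x \<le> t}"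
  have "\<pi> ` {k \<in> idx M. \<mu> k \<le> t} \<subseteq> {x \<in> J. F x \<le> t}"
    using \<pi> bij_betw_apply[OF \<pi>(1)] by auto
  from finite_subset[OF this fin] show "finite {k \<in> idx M. \<mu> k \<le> t}"
  proof (rule finite_imageD)
    show "inj_on \<pi> {k \<in> idx M. \<mu> k \<le> t}"
      using \<pi>(1) by (auto simp: bij_betw_def intro: inj_on_subset)
  qed
qed

locale shifted_zeros =
  fixes n :: nat and a b :: "nat \<Rightarrow> real" and N :: enat and lam :: "nat \<Rightarrow> real"
  assumes a_nonneg: "\<And>k. k \<in> {1..n} \<Longrightarrow> 0 \<le> a k"
    and b_nonneg: "\<And>k. k \<in> {1..n} \<Longrightarrow> 0 \<le> b k"
    and lam_nonneg: "\<And>m. m \<in> idx N \<Longrightarrow> 0 \<le> lam m"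
    and summable_exp: "\<And>s. 0 < s \<Longrightarrow> (\<lambda>m. exp (- lam m * s)) summable_on idx N"
begin

lemma finite_lam_le: "finite {m \<in> idx N. lam m \<le> t}"
proof -
  \<comment> \<open>Terms of a convergent series are eventually below \<open>exp (- t)\<close>.\<close>
  have "(\<lambda>m. if m \<in> idx N then exp (- lam m * 1) else 0) \<longlonglongrightarrow> 0"
    using sums_summable[OF sums_if_infsum[OF summable_exp[of 1]]] by (intro summable_LIMSEQ_zero) simp
  then have "\<forall>\<^sub>F m in sequentially. (if m \<in> idx N then exp (- lam m * 1) else 0) < exp (- t)"
    by (rule order_tendstoD) simp
  then obtain m0 where m0: "\<And>m. m \<ge> m0 \<Longrightarrow> m \<in> idx N \<Longrightarrow> exp (- lam m) < exp (- t)"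
    unfolding eventually_sequentially by (auto split: if_splits)
  have "{m \<in> idx N. lam m \<le> t} \<subseteq> {..<m0}"
  proof (rule subsetI, rule ccontr)
    fix m assume "m \<in> {m \<in> idx N. lam m \<le> t}" "m \<notin> {..<m0}"
    then show False using m0[of m] by simp
  qed
  then show ?thesis by (rule finite_subset) simp
qed

lemma rho_fun_neg:
  assumes "t \<le> 0"
  shows "rho_fun n a b t = 0"
proof -
  have "max 0 (t - a k) = 0" "max 0 (t - b k) = 0" if "k \<in> {1..n}" for k
    using a_nonneg[OF that] b_nonneg[OF that] assms by simp_all
  then show ?thesis unfolding rho_fun_eq_sum_max by simp
qed

lemma rho_summable: "(\<lambda>m. rho_fun n a b (t - lam m)) summable_on idx N"
proof -
  have "(\<lambda>m. rho_fun n a b (t - lam m)) summable_on {m \<in> idx N. lam m \<le> t}"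
    using finite_lam_le by (rule summable_on_finite)
  also have "?this \<longleftrightarrow> ?thesis"
    by (intro summable_on_cong_neutral) (auto simp: rho_fun_neg)
  finally show ?thesis .
qed

lemma phi_fun_eq_sum: "phi_fun n a b N lam t = (\<Sum>m\<in>{m \<in> idx N. lam m \<le> t}. rho_fun n a b (t - lam m))"
  unfolding phi_fun_def using finite_lam_le
  by (rule infsum_eq_sum_superset) (auto simp: rho_fun_neg)

text \<open>
  The value of \<open>\<phi>\<close> at \<open>t\<close> is the sum of \<open>(t - x)\<^sub>+\<close> over the entries \<open>x\<close> of \<open>a - Z\<close>, minus the same sum
  over \<open>b - Z\<close>. All sums are finite, as only zeros with \<open>lam m \<le> t\<close> contribute.
\<close>
lemma phi_fun_nonneg:
  assumes "weakly_majorized n b a N lam"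
  shows "0 \<le> phi_fun n a b N lam t"
proof -
  obtain M \<mu>b \<mu>a where b: "minus_zeros n b N lam M \<mu>b" and a: "minus_zeros n a N lam M \<mu>a"
    and le: "\<And>m. m \<in> idx M \<Longrightarrow> (\<Sum>k=1..m. \<mu>a k) \<le> (\<Sum>k=1..m. \<mu>b k)"
    using assms by (auto simp: weakly_majorized_def)
  define \<Lambda> where "\<Lambda> = {m \<in> idx N. lam m \<le> t}"
  have fin\<Lambda>: "finite \<Lambda>" using finite_lam_le by (simp add: \<Lambda>_def)
  have sum_eq: "(\<Sum>\<^sub>\<infinity>(j, m)\<in>{1..n} \<times> idx N. max 0 (t - (x j - (- lam m)))) = (\<Sum>m\<in>\<Lambda>. \<Sum>j=1..n. max 0 (t - lam m - x j))"
    if "\<And>k. k \<in> {1..n} \<Longrightarrow> 0 \<le> x k" for x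
  proof -
    have "(\<Sum>\<^sub>\<infinity>(j, m)\<in>{1..n} \<times> idx N. max 0 (t - (x j - (- lam m)))) =
        (\<Sum>(j, m)\<in>{1..n} \<times> \<Lambda>. max 0 (t - (x j - (- lam m))))"
    proof (intro infsum_eq_sum_superset)
      fix jm assume "jm \<in> {1..n} \<times> idx N - {1..n} \<times> \<Lambda>"
      then obtain j m where "jm = (j, m)" "j \<in> {1..n}" "m \<in> idx N" "m \<notin> \<Lambda>"
        by blast
      then show "(case jm of (j, m) \<Rightarrow> max 0 (t - (x j - (- lam m)))) = 0"
        using that[of j] by (simp add: \<Lambda>_def)
    qed (use fin\<Lambda> in \<open>auto simp: \<Lambda>_def\<close>)
    also have "\<dots> = (\<Sum>j=1..n. \<Sum>m\<in>\<Lambda>. max 0 (t - lam m - x j))"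
      by (subst sum.cartesian_product) (intro sum.cong, auto simp: algebra_simps)
    finally show ?thesis by (subst sum.swap)
  qed
  have fin: "finite {jm \<in> {1..n} \<times> idx N. (case jm of (j, m) \<Rightarrow> x j - (- lam m)) \<le> t}"
    if "\<And>k. k \<in> {1..n} \<Longrightarrow> 0 \<le> x k" for x
  proof (rule finite_subset)
    show "{jm \<in> {1..n} \<times> idx N. (case jm of (j, m) \<Rightarrow> x j - (- lam m)) \<le> t} \<subseteq> {1..n} \<times> \<Lambda>"
    proof
      fix jm assume "jm \<in> {jm \<in> {1..n} \<times> idx N. (case jm of (j, m) \<Rightarrow> x j - (- lam m)) \<le> t}"
      then obtain j m where "jm = (j, m)" "j \<in> {1..n}" "m \<in> idx N" "x j + lam m \<le> t" by auto
      then show "jm \<in> {1..n} \<times> \<Lambda>" using that[of j] by (simp add: \<Lambda>_def)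
    qed
  qed (use fin\<Lambda> in simp)
  have fin_mu: "finite {k \<in> idx M. \<mu>a k \<le> t}" "finite {k \<in> idx M. \<mu>b k \<le> t}"
    using rearrangement_sum_hinge(2)[OF a[unfolded minus_zeros_def] fin]
      rearrangement_sum_hinge(2)[OF b[unfolded minus_zeros_def] fin] a_nonneg b_nonneg by blast+
  have "mono_on (idx M) \<mu>b" using b by (simp add: minus_zeros_def nondecr_rearrangement_def)
  from sum_hinge_le_if_partial_sums_le[OF this fin_mu le]
  have "(\<Sum>\<^sub>\<infinity>k\<in>idx M. max 0 (t - \<mu>b k)) \<le> (\<Sum>\<^sub>\<infinity>k\<in>idx M. max 0 (t - \<mu>a k))" .
  also have "(\<Sum>\<^sub>\<infinity>k\<in>idx M. max 0 (t - \<mu>a k)) = (\<Sum>m\<in>\<Lambda>. \<Sum>j=1..n. max 0 (t - lam m - a j))"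
    using rearrangement_sum_hinge(1)[OF a[unfolded minus_zeros_def], of t] sum_eq[OF a_nonneg]
    by (simp add: case_prod_unfold)
  also have "(\<Sum>\<^sub>\<infinity>k\<in>idx M. max 0 (t - \<mu>b k)) = (\<Sum>m\<in>\<Lambda>. \<Sum>j=1..n. max 0 (t - lam m - b j))"
    using rearrangement_sum_hinge(1)[OF b[unfolded minus_zeros_def], of t] sum_eq[OF b_nonneg]
    by (simp add: case_prod_unfold)
  finally show ?thesis
    unfolding phi_fun_eq_sum rho_fun_eq_sum_max by (simp add: sum_subtractf \<Lambda>_def)
qed

lemma rho_fun_measurable [measurable]: "rho_fun n a b \<in> borel_measurable borel"
  unfolding rho_fun_eq_sum_max[abs_def] by measurable

lemma phi_fun_eq_suminf: "phi_fun n a b N lam t = (\<Sum>m. if m \<in> idx N then rho_fun n a b (t - lam m) else 0)"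
  unfolding phi_fun_def by (rule sums_unique[OF sums_if_infsum[OF rho_summable]])

lemma phi_fun_measurable [measurable]: "phi_fun n a b N lam \<in> borel_measurable borel"
  unfolding phi_fun_eq_suminf[abs_def] by measurable

text \<open>The bound on the integral of the modulus makes the sum over all zeros interchangeable with the integral.\<close>
lemma laplace_rho_shift:
  assumes s: "0 < s" and m: "m \<in> idx N"
  shows "has_bochner_integral lborel (\<lambda>t. indicator {0<..} t * (exp (- s * t) * rho_fun n a b (t - lam m)))
           (exp (- lam m * s) * g_fun n a b s)"
    and "(LINT t|lborel. norm (indicator {0<..} t * (exp (- s * t) * rho_fun n a b (t - lam m))))
           \<le> exp (- lam m * s) * ((\<Sum>k=1..n. exp (- s * a k) + exp (- s * b k)) / s ^ 2)"
proof -
  define A where "A = (\<lambda>x t::real. indicator {0<..} t * (exp (- s * t) * max 0 (t - (lam m + x))))"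
  have A: "has_bochner_integral lborel (A x) (exp (- lam m * s) * (exp (- s * x) / s ^ 2))" if "0 \<le> x" for x
  proof -
    have "exp (- (lam m + x) * s) = exp (- lam m * s) * exp (- s * x)"
      unfolding exp_add[symmetric] by (simp add: algebra_simps)
    then show ?thesis
      using laplace_hinge[OF s, of "lam m + x"] that lam_nonneg[OF m] by (simp add: A_def)
  qed
  have rho: "indicator {0<..} t * (exp (- s * t) * rho_fun n a b (t - lam m)) = (\<Sum>k=1..n. A (a k) t - A (b k) t)" for t
    unfolding rho_fun_eq_sum_max A_def
    by (simp add: sum_subtractf sum_distrib_left right_diff_distrib diff_diff_eq)
  have "has_bochner_integral lborel (\<lambda>t. \<Sum>k=1..n. A (a k) t - A (b k) t)
     (\<Sum>k=1..n. exp (- lam m * s) * (exp (- s * a k) / s ^ 2) - exp (- lam m * s) * (exp (- s * b k) / s ^ 2))"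
    by (intro has_bochner_integral_sum has_bochner_integral_diff A a_nonneg b_nonneg)
  also have "(\<Sum>k=1..n. exp (- lam m * s) * (exp (- s * a k) / s ^ 2) - exp (- lam m * s) * (exp (- s * b k) / s ^ 2)) =
     exp (- lam m * s) * g_fun n a b s"
    by (simp add: g_fun_def sum_distrib_left right_diff_distrib sum_divide_distrib)
  finally show int: "has_bochner_integral lborel (\<lambda>t. indicator {0<..} t * (exp (- s * t) * rho_fun n a b (t - lam m)))
           (exp (- lam m * s) * g_fun n a b s)"
    by (simp only: rho)
  have int': "has_bochner_integral lborel (\<lambda>t. \<Sum>k=1..n. A (a k) t + A (b k) t)
     (\<Sum>k=1..n. exp (- lam m * s) * (exp (- s * a k) / s ^ 2) + exp (- lam m * s) * (exp (- s * b k) / s ^ 2))"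
    by (intro has_bochner_integral_sum has_bochner_integral_add A a_nonneg b_nonneg)
  have "(LINT t|lborel. norm (indicator {0<..} t * (exp (- s * t) * rho_fun n a b (t - lam m))))
      \<le> (LINT t|lborel. (\<Sum>k=1..n. A (a k) t + A (b k) t))"
  proof (rule integral_mono)
    fix t :: real
    have pos: "0 \<le> A x t" for x by (simp add: A_def)
    have "norm (A (a k) t - A (b k) t) \<le> A (a k) t + A (b k) t" for k
      using pos[of "a k"] pos[of "b k"] by (simp add: abs_le_iff)
    then show "norm (indicator {0<..} t * (exp (- s * t) * rho_fun n a b (t - lam m))) \<le> (\<Sum>k=1..n. A (a k) t + A (b k) t)"
      unfolding rho by (rule sum_norm_le)
  next
    show "integrable lborel (\<lambda>t. norm (indicator {0<..} t * (exp (- s * t) * rho_fun n a b (t - lam m))))"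
      using int unfolding has_bochner_integral_iff by (intro integrable_norm) blast
    show "integrable lborel (\<lambda>t. \<Sum>k=1..n. A (a k) t + A (b k) t)"
      using int' unfolding has_bochner_integral_iff by blast
  qed
  also have "\<dots> = exp (- lam m * s) * ((\<Sum>k=1..n. exp (- s * a k) + exp (- s * b k)) / s ^ 2)"
    using int' by (simp add: has_bochner_integral_iff sum_distrib_left distrib_left sum_divide_distrib add_divide_distrib)
  finally show "(LINT t|lborel. norm (indicator {0<..} t * (exp (- s * t) * rho_fun n a b (t - lam m))))
           \<le> exp (- lam m * s) * ((\<Sum>k=1..n. exp (- s * a k) + exp (- s * b k)) / s ^ 2)" .
qed

lemma laplace_phi:
  assumes s: "0 < s"
  shows "has_bochner_integral lborel (\<lambda>t. indicator {0<..} t * (exp (- s * t) * phi_fun n a b N lam t))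
           (h_fun N lam s * g_fun n a b s)"
proof -
  define u where "u = (\<lambda>m t. if m \<in> idx N then indicator {0<..} t * (exp (- s * t) * rho_fun n a b (t - lam m)) else 0)"
  define B where "B = (\<Sum>k=1..n. exp (- s * a k) + exp (- s * b k)) / s ^ 2"
  have h: "(\<lambda>m. if m \<in> idx N then exp (- lam m * s) else 0) sums h_fun N lam s"
    unfolding h_fun_def by (rule sums_if_infsum[OF summable_exp[OF s]])
  have phi: "(\<Sum>m. u m t) = indicator {0<..} t * (exp (- s * t) * phi_fun n a b N lam t)" for t
  proof -
    have "(\<lambda>m. (indicator {0<..} t * exp (- s * t)) * (if m \<in> idx N then rho_fun n a b (t - lam m) else 0)) sums
       ((indicator {0<..} t * exp (- s * t)) * phi_fun n a b N lam t)"
      unfolding phi_fun_def by (intro sums_mult sums_if_infsum rho_summable)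
    then show ?thesis by (simp add: u_def sums_iff if_distrib mult.assoc cong: if_cong)
  qed
  have int: "integrable lborel (u m)" for m
    using laplace_rho_shift(1)[OF s, of m] by (cases "m \<in> idx N") (auto simp: u_def[abs_def] has_bochner_integral_iff)
  have int_u: "(LINT t|lborel. u m t) = (if m \<in> idx N then exp (- lam m * s) else 0) * g_fun n a b s" for m
    using laplace_rho_shift(1)[OF s, of m] by (cases "m \<in> idx N") (auto simp: u_def has_bochner_integral_iff)
  have 1: "AE t in lborel. summable (\<lambda>m. norm (u m t))"
  proof (intro AE_I2 summable_finite)
    fix t :: real
    show "finite {m \<in> idx N. lam m \<le> t}" by (rule finite_lam_le)
    show "norm (u m t) = 0" if "m \<notin> {m \<in> idx N. lam m \<le> t}" for m
      using that by (auto simp: u_def rho_fun_neg)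
  qed
  have 2: "summable (\<lambda>m. LINT t|lborel. norm (u m t))"
  proof (rule summable_comparison_test')
    show "summable (\<lambda>m. (if m \<in> idx N then exp (- lam m * s) else 0) * B)"
      using h by (intro summable_mult2) (simp add: sums_iff)
    show "norm (LINT t|lborel. norm (u m t)) \<le> (if m \<in> idx N then exp (- lam m * s) else 0) * B" for m
      using laplace_rho_shift(2)[OF s, of m]
      by (cases "m \<in> idx N") (simp_all add: u_def B_def)
  qed
  have "(LINT t|lborel. (\<Sum>m. u m t)) = h_fun N lam s * g_fun n a b s"
    using sums_integral[OF int 1 2] sums_mult2[OF h, of "g_fun n a b s"]
    unfolding int_u by (rule sums_unique2)
  with integrable_suminf[OF int 1 2] show ?thesis
    by (simp add: has_bochner_integral_iff phi)
qed

end

section \<open>The Stieltjes representation\<close>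

text \<open>
  A Stieltjes transform is an iterated Laplace transform. As \<open>\<phi>\<close> is non-negative, integrability of the
  outer Laplace integral at the real point \<open>Re z\<close> is absolute integrability of the double integral.
\<close>
lemma stieltjes_of_laplace:
  fixes \<phi> G :: "real \<Rightarrow> real"
  assumes [measurable]: "\<phi> \<in> borel_measurable borel" and nonneg: "\<And>t. 0 \<le> \<phi> t"
    and lap: "\<And>s. 0 < s \<Longrightarrow> has_bochner_integral lborel (\<lambda>t. indicator {0<..} t * (exp (- s * t) * \<phi> t)) (G s)"
    and z: "0 < Re z"
    and int: "integrable lborel (\<lambda>s. indicator {0<..} s * (exp (- s * Re z) * (s ^ r * G s)))"
  shows "has_bochner_integral lborel (\<lambda>t. indicator {0<..} t *\<^sub>R (of_real (\<phi> t) / (z + of_real t) ^ Suc r))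
     ((LINT s|lborel. indicator {0<..} s *\<^sub>R (exp (- of_real s * z) * of_real (s ^ r * G s))) / fact r)"
proof -
  define k where "k = (\<lambda>s t::real. indicator {0<..} s *\<^sub>R indicator {0<..} t *\<^sub>R
     (of_real (s ^ r * \<phi> t) * exp (- of_real s * (z + of_real t))))"
  have k_meas [measurable]: "(\<lambda>(s, t). k s t) \<in> borel_measurable (lborel \<Otimes>\<^sub>M lborel)"
    unfolding k_def by measurable
  have k_eq: "k s t = (exp (- of_real s * z) * of_real (s ^ r)) * of_real (indicator {0<..} t * (exp (- s * t) * \<phi> t))"
    if "0 < s" for s t
  proof -
    have "exp (- of_real s * (z + of_real t)) = exp (- of_real s * z) * complex_of_real (exp (- s * t))"
      by (simp add: distrib_left exp_diff exp_minus divide_inverse exp_of_real flip: of_real_mult)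
    then show ?thesis using that by (simp add: k_def scaleR_conv_of_real)
  qed
  have inner_t: "has_bochner_integral lborel (k s) (indicator {0<..} s *\<^sub>R (exp (- of_real s * z) * of_real (s ^ r * G s)))" for s
  proof (cases "0 < s")
    case True
    have "has_bochner_integral lborel (k s) ((exp (- of_real s * z) * of_real (s ^ r)) * of_real (G s))"
    proof -
      have "k s = (\<lambda>t. (exp (- of_real s * z) * of_real (s ^ r)) * of_real (indicator {0<..} t * (exp (- s * t) * \<phi> t)))"
        using k_eq[OF True] by (intro ext)
      then show ?thesis
        using has_bochner_integral_mult_right[OF has_bochner_integral_of_real[OF lap[OF True]],
            of "exp (- of_real s * z) * of_real (s ^ r)"] by simp
    qed
    then show ?thesis using True by (simp add: mult.assoc)
  qed (simp add: k_def[abs_def] has_bochner_integral_zero)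
  have norm_k: "(LINT t|lborel. norm (k s t)) = indicator {0<..} s * (exp (- s * Re z) * (s ^ r * G s))" for s
  proof (cases "0 < s")
    case True
    have "norm (k s t) = (exp (- s * Re z) * s ^ r) * (indicator {0<..} t * (exp (- s * t) * \<phi> t))" for t
      using True nonneg[of t] by (simp add: k_eq[OF True] norm_mult norm_power indicator_def)
    then show ?thesis using True lap[OF True] by (simp add: has_bochner_integral_iff)
  qed (simp add: k_def)
  have intk: "integrable (lborel \<Otimes>\<^sub>M lborel) (\<lambda>(s, t). k s t)"
  proof (rule lborel_pair.Fubini_integrable[OF k_meas])
    show "integrable lborel (\<lambda>s. LINT t|lborel. norm (case (s, t) of (s, t) \<Rightarrow> k s t))"
      using int by (simp add: norm_k)
    show "AE s in lborel. integrable lborel (\<lambda>t. case (s, t) of (s, t) \<Rightarrow> k s t)"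
      using inner_t by (intro AE_I2) (simp add: has_bochner_integral_iff)
  qed
  have inner_s: "(LINT s|lborel. k s t) = fact r * (indicator {0<..} t *\<^sub>R (of_real (\<phi> t) / (z + of_real t) ^ Suc r))" for t
  proof (cases "0 < t")
    case True
    have "k s t = of_real (\<phi> t) * (indicator {0<..} s *\<^sub>R (of_real (s ^ r) * exp (- of_real s * (z + of_real t))))" for s
      using True by (simp add: k_def)
    moreover have "0 < Re (z + of_real t)" using True z by simp
    ultimately have "(LINT s|lborel. k s t) = of_real (\<phi> t) * (fact r / (z + of_real t) ^ Suc r)"
      using laplace_power[of "z + of_real t" r]
      by (simp only: has_bochner_integral_iff integral_mult_right_zero)
    then show ?thesis using True by simp
  qed (simp add: k_def)
  have "has_bochner_integral lborel (\<lambda>t. LINT s|lborel. k s t)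
     (LINT s|lborel. indicator {0<..} s *\<^sub>R (exp (- of_real s * z) * of_real (s ^ r * G s)))"
    using lborel_pair.Fubini_integral[OF intk] lborel_pair.integrable_snd[OF intk] inner_t
    by (simp add: has_bochner_integral_iff)
  from has_bochner_integral_divide_zero[OF this, of "fact r"]
  have "has_bochner_integral lborel (\<lambda>t. (LINT s|lborel. k s t) / fact r)
     ((LINT s|lborel. indicator {0<..} s *\<^sub>R (exp (- of_real s * z) * of_real (s ^ r * G s))) / fact r)" .
  moreover have "(LINT s|lborel. k s t) / fact r = indicator {0<..} t *\<^sub>R (of_real (\<phi> t) / (z + of_real t) ^ Suc r)" for t
    unfolding inner_s by (cases "0 < t") simp_all
  ultimately show ?thesis by (simp only:)
qed

text \<open>
  The representing measure lives on the closed half-line, whereas the integral runs over the open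
  one; the density is set to \<open>0\<close> at the origin.
\<close>
lemma gen_stieltjes_density:
  fixes w :: "real \<Rightarrow> real"
  assumes [measurable]: "w \<in> borel_measurable borel" and nonneg: "\<And>t. 0 \<le> w t"
    and int: "\<And>x. 0 < x \<Longrightarrow> has_bochner_integral lborel (\<lambda>t. indicator {0<..} t * (w t / (t + x) ^ k)) (F x)"
    and "0 < k"
  shows "gen_stieltjes (real k) F"
proof -
  define R where "R = restrict_space lborel {0::real..}"
  define \<mu> where "\<mu> = density R (\<lambda>t. ennreal (indicator {0<..} t * w t))"
  have meas: "(\<lambda>t. indicator {0<..} t * w t) \<in> borel_measurable R"
    unfolding R_def by (rule measurable_restrict_space1) measurable
  have "integrable \<mu> (\<lambda>t. 1 / (t + x) powr real k) \<and> F x = (\<integral>t. 1 / (t + x) powr real k \<partial>\<mu>)" if x: "0 < x" for x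
  proof -
    have gm: "(\<lambda>t. 1 / (t + x) powr real k) \<in> borel_measurable R"
      unfolding R_def by (rule measurable_restrict_space1) measurable
    have eq: "indicator {0..} t *\<^sub>R ((indicator {0<..} t * w t) *\<^sub>R (1 / (t + x) powr real k)) =
        indicator {0<..} t * (w t / (t + x) ^ k)" for t
      using x by (auto simp: indicator_def powr_realpow)
    have *: "has_bochner_integral R (\<lambda>t. (indicator {0<..} t * w t) *\<^sub>R (1 / (t + x) powr real k)) (F x)"
      unfolding R_def has_bochner_integral_iff
      using int[OF x] by (subst integrable_restrict_space, simp, subst integral_restrict_space, simp)
        (simp only: eq has_bochner_integral_iff)
    have nn: "AE t in R. 0 \<le> indicator {0<..} t * w t"
      using nonneg by (intro AE_I2) simp
    show ?thesis
      using * unfolding \<mu>_def has_bochner_integral_iff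
      by (simp add: integrable_density[OF gm meas nn] integral_density[OF gm meas nn])
  qed
  moreover have "sets \<mu> = sets (restrict_space borel {0..})"
    by (simp add: \<mu>_def R_def sets_restrict_space)
  ultimately show ?thesis
    unfolding gen_stieltjes_def using \<open>0 < k\<close> by (intro conjI exI[of _ \<mu>] exI[of _ 0]) auto
qed

theorem proposition2p5:
  fixes p l n :: nat and f :: "complex \<Rightarrow> complex"
    and N :: enat and lam :: "nat \<Rightarrow> real" and a b :: "nat \<Rightarrow> real"
  assumes "p \<ge> 1" and "l \<le> p"
    and "f \<in> class_E p"
    and "zero_sequence f N lam"
    and "mono_on {1..n} a" and "\<And>k. k \<in> {1..n} \<Longrightarrow> 0 \<le> a k"
    and "mono_on {1..n} b" and "\<And>k. k \<in> {1..n} \<Longrightarrow> 0 \<le> b k"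
    and "\<And>j. j \<le> l \<Longrightarrow> (\<Sum>k=1..n. a k ^ j) = (\<Sum>k=1..n. b k ^ j)"
    and "weakly_majorized n b a N lam"
  shows "gen_stieltjes_complex (real (p - l + 2))
           (\<lambda>z. (-1) ^ (p - l + 1) * (deriv ^^ (p - l)) (log_W f n a b) z) \<and>
         (\<forall>s>0. (\<lambda>m. exp (- lam m * s)) summable_on idx N) \<and>
         (\<forall>t. (\<lambda>m. rho_fun n a b (t - lam m)) summable_on idx N) \<and>
         (\<forall>z. Re z > 0 \<longrightarrow>
           set_integrable lborel {0<..}
             (\<lambda>s. exp (- of_real s * z) *
                  of_real (s ^ (p - l + 1) * h_fun N lam s * g_fun n a b s)) \<and>
           set_integrable lborel {0<..}
             (\<lambda>t. of_real (phi_fun n a b N lam t) / (z + of_real t) ^ (p - l + 2)) \<and>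
           (-1) ^ (p - l + 1) * (deriv ^^ (p - l)) (log_W f n a b) z =
             (LINT s:{0<..}|lborel. exp (- of_real s * z) *
                  of_real (s ^ (p - l + 1) * h_fun N lam s * g_fun n a b s)) \<and>
           (LINT s:{0<..}|lborel. exp (- of_real s * z) *
                  of_real (s ^ (p - l + 1) * h_fun N lam s * g_fun n a b s)) =
             Gamma (of_nat (p - l + 2)) *
             (LINT t:{0<..}|lborel.
                of_real (phi_fun n a b N lam t) / (z + of_real t) ^ (p - l + 2)))"
proof -
  define q where "q = p - l"
  define h where "h = h_fun N lam"
  define g where "g = g_fun n a b"
  define \<phi> where "\<phi> = phi_fun n a b N lam"
  define V where "V = (\<lambda>z. (-1) ^ Suc q * (deriv ^^ q) (log_W f n a b) z)"
  obtain r Q d I c where hp: "nonpositive_hadamard_product f r Q d I c" and genus: "p = max d (degree Q)"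
    using class_E_hadamard[OF \<open>f \<in> class_E p\<close>] by blast
  interpret nonpositive_hadamard_product f r Q d I c by (rule hp)
  note zs = \<open>zero_sequence f N lam\<close>
  interpret shifted_zeros n a b N lam
    by unfold_locales
      (use assms zero_sequence_nonneg[OF zs] zero_sequence_exp_sum(1)[OF zs] in auto)
  have \<phi>_meas [measurable]: "\<phi> \<in> borel_measurable borel" unfolding \<phi>_def by (rule phi_fun_measurable)
  have \<phi>_nonneg: "0 \<le> \<phi> t" for t
    unfolding \<phi>_def by (rule phi_fun_nonneg[OF \<open>weakly_majorized n b a N lam\<close>])
  have lap: "has_bochner_integral lborel (\<lambda>t. indicator {0<..} t * (exp (- s * t) * \<phi> t)) (h s * g s)"
    if "0 < s" for s
    unfolding \<phi>_def h_def g_def by (rule laplace_phi[OF that])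
  have hg: "0 \<le> h s * g s" if "0 < s" for s
  proof -
    have "0 \<le> (LINT t|lborel. indicator {0<..} t * (exp (- s * t) * \<phi> t))"
      using \<phi>_nonneg by (intro integral_nonneg_AE AE_I2) simp
    then show ?thesis using lap[OF that] by (simp add: has_bochner_integral_iff)
  qed
  have ds: "has_bochner_integral lborel
     (\<lambda>s. indicator {0<..} s *\<^sub>R (exp (- of_real s * z) * of_real (s ^ Suc q * h s * g s))) (V z)"
    if z: "0 < Re z" for z
    unfolding V_def g_def
  proof (rule higher_deriv_log_W_laplace[OF z])
    show "max d (degree Q) \<le> l + q" using genus \<open>l \<le> p\<close> by (simp add: q_def)
    show "(\<lambda>m. zero_exp_partial m s) \<longlonglongrightarrow> h s" if "0 < s" for s
      unfolding h_def by (rule zero_sequence_exp_sum(2)[OF zs that])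
  qed (use assms hg in \<open>auto simp: g_def\<close>)
  have dt: "has_bochner_integral lborel
     (\<lambda>t. indicator {0<..} t *\<^sub>R (of_real (\<phi> t) / (z + of_real t) ^ Suc (Suc q))) (V z / fact (Suc q))"
    if z: "0 < Re z" for z
  proof -
    have norm_eq: "norm (indicator {0<..} s *\<^sub>R (exp (- of_real s * z) * of_real (s ^ Suc q * h s * g s))) =
        indicator {0<..} s * (exp (- s * Re z) * (s ^ Suc q * (h s * g s)))" for s
      using hg[of s] by (cases "0 < s") (simp_all add: norm_mult norm_power mult_ac flip: abs_mult)
    have "integrable lborel (\<lambda>s. indicator {0<..} s * (exp (- s * Re z) * (s ^ Suc q * (h s * g s))))"
      unfolding norm_eq[symmetric] using ds[OF z] unfolding has_bochner_integral_iff
      by (intro integrable_norm) blast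
    from stieltjes_of_laplace[OF \<phi>_meas \<phi>_nonneg lap z this] ds[OF z] show ?thesis
      by (simp add: has_bochner_integral_iff mult.assoc)
  qed
  have "gen_stieltjes_complex (real (Suc (Suc q))) V"
  proof -
    define F where "F = (\<lambda>x. Re (V (of_real x)))"
    have real_int: "has_bochner_integral lborel (\<lambda>t. indicator {0<..} t * (fact (Suc q) * \<phi> t / (t + x) ^ Suc (Suc q))) (F x)"
      if "0 < x" for x
    proof -
      have "Re (fact (Suc q) * (indicator {0<..} t *\<^sub>R (of_real (\<phi> t) / (of_real x + of_real t) ^ Suc (Suc q)))) =
          indicator {0<..} t * (fact (Suc q) * \<phi> t / (t + x) ^ Suc (Suc q))" for t
      proof -
        have "fact (Suc q) * (indicator {0<..} t *\<^sub>R (of_real (\<phi> t) / (of_real x + of_real t) ^ Suc (Suc q))) =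
          complex_of_real (indicator {0<..} t * (fact (Suc q) * \<phi> t / (t + x) ^ Suc (Suc q)))"
          by (simp add: scaleR_conv_of_real add.commute del: fact_Suc power_Suc)
        then show ?thesis by (simp only: Re_complex_of_real)
      qed
      moreover have "Re (fact (Suc q) * (V (of_real x) / fact (Suc q))) = F x"
        by (simp add: F_def del: fact_Suc)
      ultimately show ?thesis
        using has_bochner_integral_Re[OF has_bochner_integral_mult_right[OF dt[of "of_real x"], of "fact (Suc q)"]] that
        by (simp only: Re_complex_of_real)
    qed
    have "gen_stieltjes (real (Suc (Suc q))) F"
    proof (rule gen_stieltjes_density)
      show "(\<lambda>t. fact (Suc q) * \<phi> t) \<in> borel_measurable borel" by measurable
      show "0 \<le> fact (Suc q) * \<phi> t" for t using \<phi>_nonneg by simp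
    qed (use real_int in auto)
    moreover have "V (of_real x) = of_real (F x)" if "0 < x" for x
    proof -
      have "has_bochner_integral lborel
        (\<lambda>s. complex_of_real (indicator {0<..} s * (exp (- s * x) * (s ^ Suc q * h s * g s)))) (V (of_real x))"
        using ds[of "of_real x"] that by (simp add: scaleR_conv_of_real exp_of_real flip: of_real_mult of_real_minus)
      then have "V (of_real x) = (LINT s|lborel. complex_of_real (indicator {0<..} s * (exp (- s * x) * (s ^ Suc q * h s * g s))))"
        by (simp only: has_bochner_integral_iff)
      then have "V (of_real x) \<in> \<real>" by (simp only: integral_complex_of_real Reals_of_real)
      then show ?thesis by (simp add: F_def)
    qed
    ultimately show ?thesis unfolding gen_stieltjes_complex_def by blast
  qed
  moreover have "Gamma (of_nat (Suc (Suc q))) = (fact (Suc q) :: complex)"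
    using Gamma_fact[of "Suc q", where 'a = complex] by simp
  moreover note ds dt rho_summable zero_sequence_exp_sum(1)[OF zs]
  ultimately show ?thesis
    unfolding set_integrable_def set_lebesgue_integral_def has_bochner_integral_iff
      V_def h_def g_def \<phi>_def q_def
    by (simp del: fact_Suc power_Suc of_nat_Suc)
qed

end
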